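(* Let $d\ge 1$, and let $C$ be a modest clone on $\mathbb N$ containing all $d$-ary operations on $\mathbb N$ with range $\{0,1\}$. Then there are $2^{\mathfrak c}$ many clones $D$ on $\mathbb N$ with $D\cap \mathscr O^{(d)} = C\cap \mathscr O^{(d)}$, where $\mathfrak c=2^{\aleph_0}$.
   Context: An operation on $X=\mathbb N$ is a function $f:X^n\to X$ for some positive natural number $n$; $\mathscr O^{(n)} = X^{X^n}$ is the set of all $n$-ary operations. A clone on $X$ is a set of operations that contains all projection functions and is closed under composition. For $\alpha\in\mathbb R$, an operation $f:X^n\to X$ is $\alpha$-modest if for all natural numbers $N$ and all $Y\subseteq X$ of cardinality $N$, the range of $f\upharpoonright Y^n$ has at most $\alpha N$ elements. $f$ is modest if it is $\alpha$-modest for some $\alpha$. A clone $C$ is modest if all operations in $C$ are modest. *)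

theory Defs
  imports Complex_Main "HOL-Library.FuncSet" "HOL-Library.Equipollence"
begin

text \<open>
  The \<open>n\<close>-tuples \<open>Y\<^sup>n\<close> are the lists of length \<open>n\<close> over \<open>Y\<close>. An operation carries its arity
  explicitly, and is \<^const>\<open>undefined\<close> off the tuples of that length: this makes equality of pairs
  coincide with equality of operations (the arity is not recoverable from the second component,
  as \<open>undefined :: nat\<close> is also an ordinary value).
\<close>

type_synonym operation = "nat \<times> (nat list \<Rightarrow> nat)"

definition tuples :: "nat set \<Rightarrow> nat \<Rightarrow> nat list set" where
  "tuples Y n = {xs \<in> lists Y. length xs = n}"

definition nary_operations :: "nat \<Rightarrow> operation set" where
  "nary_operations n = {n} \<times> (tuples UNIV n \<rightarrow>\<^sub>E UNIV)"

definition operations :: "operation set" where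
  "operations = (\<Union>n\<in>{1..}. nary_operations n)"

definition op_image :: "operation \<Rightarrow> nat set \<Rightarrow> nat set" where
  "op_image f Y = snd f ` tuples Y (fst f)"

definition projection :: "nat \<Rightarrow> nat \<Rightarrow> operation" where
  "projection n i = (n, \<lambda>xs\<in>tuples UNIV n. xs ! i)"

text \<open>The \<open>m\<close>-ary operation \<open>f(g\<^sub>1, \<dots>, g\<^sub>n)\<close>, for \<open>f\<close> of arity \<open>n\<close> and \<open>gs = [g\<^sub>1, \<dots>, g\<^sub>n]\<close>
  a list of \<open>m\<close>-ary operations.\<close>

definition composition :: "nat \<Rightarrow> operation \<Rightarrow> operation list \<Rightarrow> operation" where
  "composition m f gs = (m, \<lambda>xs\<in>tuples UNIV m. snd f (map (\<lambda>g. snd g xs) gs))"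

definition clone :: "operation set \<Rightarrow> bool" where
  "clone C \<longleftrightarrow>
     C \<subseteq> operations \<and>
     (\<forall>n\<ge>1. \<forall>i<n. projection n i \<in> C) \<and>
     (\<forall>m\<ge>1. \<forall>f\<in>C. \<forall>gs. length gs = fst f \<and> set gs \<subseteq> C \<inter> nary_operations m
        \<longrightarrow> composition m f gs \<in> C)"

definition alpha_modest :: "real \<Rightarrow> operation \<Rightarrow> bool" where
  "alpha_modest \<alpha> f \<longleftrightarrow>
     (\<forall>N Y. finite Y \<and> card Y = N \<longrightarrow> real (card (op_image f Y)) \<le> \<alpha> * real N)"

definition modest :: "operation \<Rightarrow> bool" where
  "modest f \<longleftrightarrow> (\<exists>\<alpha>. alpha_modest \<alpha> f)"

definition modest_clone :: "operation set \<Rightarrow> bool" where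
  "modest_clone C \<longleftrightarrow> clone C \<and> (\<forall>f\<in>C. modest f)"

end

theory Submission
  imports Defs "HOL-Library.Nat_Bijection"
begin

text \<open>
  There are only \<open>2\<^sup>\<cc>\<close> sets of operations, so the point is the lower bound. Put
  \<open>C\<^sub>d = C \<inter> nary_operations d\<close>. Every \<open>d\<close>-ary operation with values in \<open>{0, 1}\<close> lies in \<open>C\<^sub>d\<close>,
  hence adding two-valued operations of any arity to \<open>C\<^sub>d\<close> and closing under composition creates no new
  \<open>d\<close>-ary operation (\<open>generated_clone_fragment\<close>). It therefore suffices to find continuum many two-valued
  operations \<open>f\<^sub>j\<close> of arity \<open>d + 1\<close> such that no \<open>f\<^sub>j\<close> is generated by \<open>C\<^sub>d\<close> and the other ones: then the
  sets \<open>U\<close> of indices yield pairwise different clones.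

  Independence is a circuit-counting argument, in the spirit of Shannon. Let a circuit of \<open>s\<close> gates over
  \<open>C\<^sub>d\<close> and some \<open>f\<^sub>i\<close>, \<open>i \<noteq> j\<close>, compute \<open>f\<^sub>j\<close>. All operations in the circuit are modest, so on inputs
  below \<open>n\<close> all intermediate values lie in a set \<open>Z\<close> of size \<open>O(n)\<close>. After renaming \<open>Z\<close> to an initial
  segment of length \<open>M\<close> proportional to \<open>n\<close>, a gate from \<open>C\<^sub>d\<close> is one of at most \<open>M ^ (M ^ d)\<close> tables, and a gate
  \<open>f\<^sub>i\<close> that takes the value 1 on only \<open>O(M ^ d)\<close> tuples of \<open>Z\<close> is one of \<open>M ^ O(M ^ d)\<close> tables. Hence
  only \<open>n ^ O(n ^ d)\<close> functions arise, and a subset of a fixed set of more than \<open>n ^ d * log n\<close> tuples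
  (with a large enough factor) can be chosen which is none of them.

  The \<open>f\<^sub>j\<close> must thus be complicated on certain initial segments and sparse on every much smaller
  set. This is what locally sparse graphs provide: a graph on \<open>n\<close> vertices in which small vertex sets span
  few edges, but which has many more than \<open>n * log n\<close> edges, is found by a greedy construction
  (\<open>sparse_graph_greedy\<close>). Prefixing its edges by arbitrary \<open>(d - 1)\<close>-tuples gives the hyperedges among which
  the hard set is chosen (\<open>level_exists\<close>). The construction is iterated along fast growing segments, level \<open>k\<close>
  defeating circuits of size \<open>k\<close> and being sparse on all sets relevant to the earlier levels. Finally, \<open>f\<^sub>j\<close> is
  the indicator of the hard sets of the levels \<open>k \<in> A j\<close>, for an almost disjoint family of infinite sets \<open>A j\<close>
  indexed by the sets of natural numbers: a circuit for \<open>f\<^sub>j\<close> from finitely many other \<open>f\<^sub>i\<close> is refuted at a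
  large level \<open>k \<in> A j\<close> that lies in none of the sets \<open>A i\<close> (\<open>indicator_not_generated\<close>).
\<close>

section \<open>Tuples, compositions and generated clones\<close>

lemma mem_tuples_iff: "xs \<in> tuples Y n \<longleftrightarrow> set xs \<subseteq> Y \<and> length xs = n"
  by (auto simp: tuples_def)

lemma tuples_eq: "tuples Y n = {xs. set xs \<subseteq> Y \<and> length xs = n}"
  by (auto simp: tuples_def)

lemma nary_operations_iff: "f \<in> nary_operations n \<longleftrightarrow> fst f = n \<and> snd f \<in> extensional (tuples UNIV n)"
  by (cases f) (auto simp: nary_operations_def PiE_def)

lemma projection_nary: "projection n i \<in> nary_operations n"
  by (auto simp: nary_operations_iff projection_def)

lemma composition_nary: "composition n f gs \<in> nary_operations n"
  by (auto simp: nary_operations_iff composition_def)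

lemma snd_composition:
  "length xs = n \<Longrightarrow> snd (composition n f gs) xs = snd f (map (\<lambda>g. snd g xs) gs)"
  by (simp add: composition_def mem_tuples_iff)

lemma snd_projection: "length xs = n \<Longrightarrow> snd (projection n i) xs = xs ! i"
  by (simp add: projection_def mem_tuples_iff)

lemma nary_operations_eqI:
  assumes "f \<in> nary_operations n" "g \<in> nary_operations n"
    and "\<And>xs. length xs = n \<Longrightarrow> snd f xs = snd g xs"
  shows "f = g"
proof (rule prod_eqI)
  show "fst f = fst g" using assms(1,2) by (simp add: nary_operations_iff)
  show "snd f = snd g"
    using assms by (intro extensionalityI[of _ "tuples UNIV n"]) (auto simp: nary_operations_iff mem_tuples_iff)
qed

lemma composition_assoc:
  assumes "length hs = m"
  shows "composition n (composition m f gs) hs = composition n f (map (\<lambda>g. composition n g hs) gs)"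
  by (rule nary_operations_eqI[OF composition_nary composition_nary])
     (simp add: snd_composition assms o_def)

lemma composition_projection:
  assumes "i < n" "length gs = n" "gs ! i \<in> nary_operations m"
  shows "composition m (projection n i) gs = gs ! i"
  by (rule nary_operations_eqI[OF composition_nary assms(3)])
     (simp add: snd_composition snd_projection assms)

lemma composition_projections:
  assumes "f \<in> nary_operations n"
  shows "composition n f (map (projection n) [0..<n]) = f"
proof (rule nary_operations_eqI[OF composition_nary assms])
  fix xs :: "nat list" assume xs: "length xs = n"
  then have "map (\<lambda>g. snd g xs) (map (projection n) [0..<n]) = xs"
    by (intro nth_equalityI) (auto simp: snd_projection)
  then show "snd (composition n f (map (projection n) [0..<n])) xs = snd f xs"
    using xs by (simp add: snd_composition)
qed

text \<open>
  The \<open>n\<close>-ary part of the clone generated by \<open>S\<close>. Fixing \<open>n\<close> and applying only generators, not arbitrary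
  members of the clone, makes it the closure of the projections in an algebra with basic operations \<open>S\<close>, and
  induction becomes induction on terms.
\<close>

inductive_set term_ops :: "operation set \<Rightarrow> nat \<Rightarrow> operation set" for S n where
  var: "i < n \<Longrightarrow> projection n i \<in> term_ops S n"
| app: "f \<in> S \<Longrightarrow> length gs = fst f \<Longrightarrow> \<forall>g\<in>set gs. g \<in> term_ops S n
        \<Longrightarrow> composition n f gs \<in> term_ops S n"

definition generated_clone :: "operation set \<Rightarrow> operation set" where
  "generated_clone S = (\<Union>n\<in>{1..}. term_ops S n)"

lemma term_ops_nary: "f \<in> term_ops S n \<Longrightarrow> f \<in> nary_operations n"
  by (induction rule: term_ops.induct) (auto simp: projection_nary composition_nary)

lemma generator_in_term_ops: "f \<in> S \<Longrightarrow> f \<in> nary_operations n \<Longrightarrow> f \<in> term_ops S n"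
proof -
  assume f: "f \<in> S" "f \<in> nary_operations n"
  have "composition n f (map (projection n) [0..<n]) \<in> term_ops S n"
    using f by (intro term_ops.app) (auto simp: nary_operations_iff intro: term_ops.var)
  then show ?thesis using composition_projections[OF f(2)] by simp
qed

lemma composition_in_term_ops:
  assumes "h \<in> term_ops S m" "length gs = m" "set gs \<subseteq> term_ops S n"
  shows "composition n h gs \<in> term_ops S n"
  using assms(1)
proof induction
  case (var i)
  then have "gs ! i \<in> term_ops S n" using assms(2,3) by (metis nth_mem subsetD)
  then show ?case using composition_projection[OF var assms(2)] term_ops_nary by metis
next
  case (app f fs)
  then show ?case by (auto simp: composition_assoc[OF assms(2)] intro!: term_ops.app)
qed

lemma generated_clone_nary:
  assumes "n \<ge> 1" shows "generated_clone S \<inter> nary_operations n = term_ops S n"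
proof -
  have "f \<in> term_ops S n" if "f \<in> term_ops S m" "f \<in> nary_operations n" for f m
    using that term_ops_nary[OF that(1)] by (auto simp: nary_operations_iff)
  then show ?thesis using assms by (auto simp: generated_clone_def term_ops_nary)
qed

lemma clone_generated_clone: "clone (generated_clone S)"
  unfolding clone_def
proof (intro conjI allI impI ballI)
  show "generated_clone S \<subseteq> operations"
    by (auto simp: generated_clone_def operations_def dest: term_ops_nary)
  show "projection n i \<in> generated_clone S" if "1 \<le> n" "i < n" for n i
    using that by (auto simp: generated_clone_def intro!: term_ops.var)
next
  fix m f gs
  assume m: "1 \<le> m" and f: "f \<in> generated_clone S"
    and gs: "length gs = fst f \<and> set gs \<subseteq> generated_clone S \<inter> nary_operations m"
  obtain n where n: "f \<in> term_ops S n" using f by (auto simp: generated_clone_def)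
  have "set gs \<subseteq> term_ops S m" using gs generated_clone_nary[OF m] by blast
  moreover have "length gs = n" using gs term_ops_nary[OF n] by (simp add: nary_operations_iff)
  ultimately have "composition m f gs \<in> term_ops S m" by (rule composition_in_term_ops[OF n, rotated])
  then show "composition m f gs \<in> generated_clone S" using m by (auto simp: generated_clone_def)
qed

section \<open>The d-ary fragment of a generated clone\<close>

definition two_valued :: "operation \<Rightarrow> bool" where
  "two_valued f \<longleftrightarrow> op_image f UNIV \<subseteq> {0, 1}"

lemma two_valued_iff: "two_valued f \<longleftrightarrow> (\<forall>xs. length xs = fst f \<longrightarrow> snd f xs \<in> {0, 1})"
  unfolding two_valued_def op_image_def image_subset_iff by (auto simp: mem_tuples_iff)

text \<open>
  The hypothesis on \<open>C\<close> concerns ranges equal to \<open>{0, 1}\<close>; the constants are recovered by composition. The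
  operation \<open>\<chi>\<close> deviates from \<open>c\<close> only where its first argument is 2, a value that \<open>\<chi>\<close> itself never takes.
\<close>

lemma two_valued_in_clone:
  assumes "clone C" "d \<ge> 1"
    and all: "\<forall>f\<in>nary_operations d. op_image f UNIV = {0, 1} \<longrightarrow> f \<in> C"
    and f: "f \<in> nary_operations d" "two_valued f"
  shows "f \<in> C"
proof (cases "op_image f UNIV = {0, 1}")
  case True
  then show ?thesis using all f by blast
next
  case False
  have "replicate d 0 \<in> tuples UNIV d" by (simp add: mem_tuples_iff)
  then have "op_image f UNIV \<noteq> {}" using f by (auto simp: op_image_def nary_operations_iff)
  with False f(2) obtain c where c: "c = 0 \<or> c = 1" and fc: "op_image f UNIV = {c}"
    unfolding two_valued_def subset_insert_iff subset_singleton_iff by (auto split: if_splits)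
  define \<chi> :: operation where
    "\<chi> = (d, \<lambda>xs\<in>tuples UNIV d. if xs ! 0 = 2 then 1 - c else c)"
  have \<chi>n: "\<chi> \<in> nary_operations d" by (simp add: \<chi>_def nary_operations_iff)
  have "replicate d 2 \<in> tuples UNIV d" by (simp add: mem_tuples_iff)
  then have "op_image \<chi> UNIV = {1 - c, c}"
    using \<open>replicate d 0 \<in> tuples UNIV d\<close> assms(2) c
    by (auto simp: \<chi>_def op_image_def image_iff intro!: bexI[where x = "replicate d 2"] bexI[where x = "replicate d 0"])
  then have "\<chi> \<in> C" using all \<chi>n c by auto
  then have "composition d \<chi> (replicate d \<chi>) \<in> C"
    using assms(1,2) \<chi>n unfolding clone_def by (auto simp: \<chi>_def)
  moreover have "composition d \<chi> (replicate d \<chi>) = f"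
  proof (rule nary_operations_eqI[OF composition_nary f(1)])
    fix xs :: "nat list" assume xs: "length xs = d"
    have "snd f xs = c" using fc f(1) xs by (auto simp: op_image_def nary_operations_iff mem_tuples_iff)
    moreover have "snd \<chi> xs \<noteq> 2" using xs c by (auto simp: \<chi>_def mem_tuples_iff)
    then have "snd \<chi> (replicate d (snd \<chi> xs)) = c"
      using assms(2) by (simp add: \<chi>_def mem_tuples_iff)
    ultimately show "snd (composition d \<chi> (replicate d \<chi>)) xs = snd f xs"
      using xs by (simp add: snd_composition)
  qed
  ultimately show ?thesis by simp
qed

text \<open>
  Substituting members of \<open>C\<close> of arity \<open>d\<close> into a term leads back into \<open>C\<close>: at a gate from \<open>C\<close> because \<open>C\<close> is
  closed under composition, at a gate from \<open>B\<close> because the result is a two-valued operation of arity \<open>d\<close>.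
  Substituting the projections shows that the \<open>d\<close>-ary terms themselves lie in \<open>C\<close>.
\<close>

lemma generated_clone_fragment:
  assumes C: "clone C" and d: "d \<ge> 1"
    and all: "\<forall>f\<in>nary_operations d. op_image f UNIV = {0, 1} \<longrightarrow> f \<in> C"
    and B: "\<forall>f\<in>B. two_valued f"
  shows "generated_clone (C \<inter> nary_operations d \<union> B) \<inter> nary_operations d = C \<inter> nary_operations d"
proof -
  let ?S = "C \<inter> nary_operations d \<union> B"
  have closed: "composition d h gs \<in> C"
    if "h \<in> term_ops ?S n" "length gs = n" "set gs \<subseteq> C \<inter> nary_operations d" for h gs n
    using that
  proof (induction)
    case (var i)
    then have "gs ! i \<in> C \<inter> nary_operations d" by (metis nth_mem subsetD)
    then show ?case using composition_projection[of i n gs d] var by auto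
  next
    case (app f fs)
    let ?hs = "map (\<lambda>g. composition d g gs) fs"
    have hs: "set ?hs \<subseteq> C \<inter> nary_operations d" "length ?hs = fst f"
      using app by (auto simp: composition_nary)
    have "composition d f ?hs \<in> C"
    proof (cases "f \<in> B")
      case True
      then have "two_valued (composition d f ?hs)"
        using B hs(2) by (auto simp: two_valued_iff composition_def mem_tuples_iff)
      then show ?thesis using two_valued_in_clone[OF C d all composition_nary] by blast
    next
      case False
      then show ?thesis using app hs C d unfolding clone_def by blast
    qed
    then show ?case using composition_assoc[OF app.prems(1)] by simp
  qed
  have "h \<in> C" if h: "h \<in> term_ops ?S d" for h
  proof -
    have "set (map (projection d) [0..<d]) \<subseteq> C \<inter> nary_operations d"
      using C d by (auto simp: clone_def projection_nary)
    then have "composition d h (map (projection d) [0..<d]) \<in> C"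
      using closed[OF h] by simp
    then show ?thesis using composition_projections term_ops_nary[OF h] by metis
  qed
  then show ?thesis
    using generated_clone_nary[OF d, of ?S] by (auto intro: generator_in_term_ops term_ops_nary)
qed

section \<open>Modest operations\<close>

lemma modest_iff: "modest f \<longleftrightarrow> (\<exists>a::nat. \<forall>Y. finite Y \<longrightarrow> card (op_image f Y) \<le> a * card Y)"
proof
  assume "modest f"
  then obtain \<alpha> where \<alpha>: "\<And>Y. finite Y \<Longrightarrow> real (card (op_image f Y)) \<le> \<alpha> * real (card Y)"
    unfolding modest_def alpha_modest_def by auto
  have "card (op_image f Y) \<le> nat \<lceil>\<alpha>\<rceil> * card Y" if "finite Y" for Y
  proof -
    have "\<alpha> * real (card Y) \<le> real (nat \<lceil>\<alpha>\<rceil>) * real (card Y)"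
      by (intro mult_right_mono) (auto simp: of_nat_ceiling)
    with \<alpha>[OF that] have "real (card (op_image f Y)) \<le> real (nat \<lceil>\<alpha>\<rceil> * card Y)" by simp
    then show ?thesis by (rule of_nat_le_iff[THEN iffD1])
  qed
  then show "\<exists>a::nat. \<forall>Y. finite Y \<longrightarrow> card (op_image f Y) \<le> a * card Y" by blast
next
  assume "\<exists>a::nat. \<forall>Y. finite Y \<longrightarrow> card (op_image f Y) \<le> a * card Y"
  then obtain a :: nat where "\<And>Y. finite Y \<Longrightarrow> card (op_image f Y) \<le> a * card Y" by blast
  then have "alpha_modest (real a) f"
    unfolding alpha_modest_def by (metis of_nat_le_iff of_nat_mult)
  then show "modest f" by (auto simp: modest_def)
qed

lemma finite_tuples: "finite Y \<Longrightarrow> finite (tuples Y n)"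
  by (simp add: tuples_eq finite_lists_length_eq)

lemma card_tuples: "finite Y \<Longrightarrow> card (tuples Y n) = card Y ^ n"
  by (simp add: tuples_eq card_lists_length_eq)

lemma finite_op_image: "finite Y \<Longrightarrow> finite (op_image f Y)"
  by (simp add: op_image_def finite_tuples)

lemma card_union_op_image:
  assumes "finite W" "\<forall>u\<in>W. modest u"
  shows "\<exists>a. \<forall>Y. finite Y \<longrightarrow> card (\<Union>u\<in>W. op_image u Y) \<le> a * card Y"
proof -
  have "\<forall>u\<in>W. \<exists>a. \<forall>Y. finite Y \<longrightarrow> card (op_image u Y) \<le> a * card Y"
    using assms(2) by (simp add: modest_iff)
  then obtain a where a: "\<And>u Y. u \<in> W \<Longrightarrow> finite Y \<Longrightarrow> card (op_image u Y) \<le> a u * card Y"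
    by metis
  have "card (\<Union>u\<in>W. op_image u Y) \<le> (\<Sum>u\<in>W. a u) * card Y" if "finite Y" for Y
  proof -
    have "card (\<Union>u\<in>W. op_image u Y) \<le> (\<Sum>u\<in>W. card (op_image u Y))"
      by (rule card_UN_le[OF assms(1)])
    also have "\<dots> \<le> (\<Sum>u\<in>W. a u * card Y)" using a that by (intro sum_mono) auto
    finally show ?thesis by (simp add: sum_distrib_right)
  qed
  then show ?thesis by blast
qed

text \<open>
  Values of the inner operations on \<open>Y\<close> are the only arguments that \<open>f\<close> receives, so linear bounds on
  image sizes are preserved under composition.
\<close>

lemma op_image_composition:
  assumes "length gs = fst f" "set gs \<subseteq> nary_operations n"
  shows "op_image (composition n f gs) Y \<subseteq> op_image f (\<Union>g\<in>set gs. op_image g Y)"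
proof
  fix y assume "y \<in> op_image (composition n f gs) Y"
  then obtain xs where xs: "xs \<in> tuples Y n" "y = snd f (map (\<lambda>g. snd g xs) gs)"
    by (auto simp: op_image_def composition_def mem_tuples_iff)
  have "snd g xs \<in> op_image g Y" if "g \<in> set gs" for g
    using that xs(1) assms(2) by (auto simp: op_image_def nary_operations_iff)
  then have "map (\<lambda>g. snd g xs) gs \<in> tuples (\<Union>g\<in>set gs. op_image g Y) (fst f)"
    using assms(1) by (auto simp: mem_tuples_iff)
  then show "y \<in> op_image f (\<Union>g\<in>set gs. op_image g Y)"
    using xs(2) by (auto simp: op_image_def)
qed

lemma modest_composition:
  assumes "modest f" "length gs = fst f" "set gs \<subseteq> nary_operations n" "\<forall>g\<in>set gs. modest g"
  shows "modest (composition n f gs)"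
proof -
  obtain a where a: "\<And>Y. finite Y \<Longrightarrow> card (op_image f Y) \<le> a * card Y"
    using assms(1) by (auto simp: modest_iff)
  obtain b where b: "\<And>Y. finite Y \<Longrightarrow> card (\<Union>g\<in>set gs. op_image g Y) \<le> b * card Y"
    using card_union_op_image[of "set gs"] assms(4) by blast
  have "card (op_image (composition n f gs) Y) \<le> (a * b) * card Y" if Y: "finite Y" for Y
  proof -
    let ?Z = "\<Union>g\<in>set gs. op_image g Y"
    have Z: "finite ?Z" using Y by (simp add: finite_op_image)
    have "card (op_image (composition n f gs) Y) \<le> card (op_image f ?Z)"
      using op_image_composition[OF assms(2,3)] finite_op_image[OF Z] by (intro card_mono) auto
    also have "\<dots> \<le> a * (b * card Y)" using a[OF Z] b[OF Y] by (meson le_trans mult_le_mono2)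
    finally show ?thesis by (simp add: mult.assoc)
  qed
  then show ?thesis by (auto simp: modest_iff)
qed

lemma modest_projection: assumes "i < n" shows "modest (projection n i)"
proof -
  have "card (op_image (projection n i) Y) \<le> 1 * card Y" if "finite Y" for Y
  proof -
    have "op_image (projection n i) Y \<subseteq> Y"
      using assms by (force simp: op_image_def projection_def mem_tuples_iff)
    then show ?thesis using card_mono[OF that] by simp
  qed
  then show ?thesis unfolding modest_iff by blast
qed

lemma modest_two_valued: assumes "two_valued f" "fst f \<ge> 1" shows "modest f"
proof -
  have "card (op_image f Y) \<le> 2 * card Y" if Y: "finite Y" for Y
  proof (cases "Y = {}")
    case True
    then have "tuples Y (fst f) = {}" using assms(2) by (auto simp: mem_tuples_iff)
    then show ?thesis by (simp add: op_image_def)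
  next
    case False
    have "op_image f Y \<subseteq> {0, 1}"
      using assms(1) by (auto simp del: insert_iff simp: two_valued_iff op_image_def mem_tuples_iff)
    then have "card (op_image f Y) \<le> 2" using card_mono[of "{0, 1::nat}" "op_image f Y"] by simp
    also have "\<dots> \<le> 2 * card Y" using False Y by (simp add: Suc_leI card_gt_0_iff)
    finally show ?thesis .
  qed
  then show ?thesis by (auto simp: modest_iff)
qed

lemma modest_term_ops:
  assumes "f \<in> term_ops S n" "\<forall>f\<in>S. modest f" shows "modest f"
  using assms(1)
proof induction
  case (var i)
  then show ?case by (rule modest_projection)
next
  case (app f gs)
  then show ?case using assms(2) term_ops_nary by (intro modest_composition) auto
qed

section \<open>Circuits\<close>

text \<open>
  A circuit with \<open>s\<close> gates, represented by the set of the operations at its nodes. In contrast to the derivation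
  of a single term, it exposes all intermediate operations at once, and these must be controlled simultaneously.
\<close>

inductive circuit :: "operation set \<Rightarrow> nat \<Rightarrow> operation set \<Rightarrow> nat \<Rightarrow> bool" for S n where
  inputs: "circuit S n (projection n ` {..<n}) 0"
| gate: "circuit S n W s \<Longrightarrow> f \<in> S \<Longrightarrow> length gs = fst f \<Longrightarrow> set gs \<subseteq> W
          \<Longrightarrow> circuit S n (insert (composition n f gs) W) (Suc s)"

lemma circuit_finite: "circuit S n W s \<Longrightarrow> finite W"
  by (induction rule: circuit.induct) auto

lemma circuit_inputs: "circuit S n W s \<Longrightarrow> projection n ` {..<n} \<subseteq> W"
  by (induction rule: circuit.induct) auto

lemma circuit_subset: "circuit S n W s \<Longrightarrow> W \<subseteq> term_ops S n"
  by (induction rule: circuit.induct) (auto intro!: term_ops.intros)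

lemma circuit_mono: "circuit S n W s \<Longrightarrow> S \<subseteq> S' \<Longrightarrow> circuit S' n W s"
  by (induction rule: circuit.induct) (auto intro: circuit.intros)

lemma circuit_Un:
  assumes "circuit S n W s" "circuit S n W' s'"
  shows "circuit S n (W \<union> W') (s + s')"
  using assms(2)
proof induction
  case inputs
  then show ?case using assms(1) circuit_inputs[OF assms(1)] by (simp add: Un_absorb2)
next
  case (gate W' s' f gs)
  then show ?case using circuit.gate[of S n "W \<union> W'" "s + s'" f gs] by auto
qed

lemma term_ops_circuit:
  assumes "h \<in> term_ops S n" shows "\<exists>W s. circuit S n W s \<and> h \<in> W"
  using assms
proof induction
  case (var i)
  then show ?case using circuit.inputs[of S n] by blast
next
  case (app f gs)
  have "\<exists>W s. circuit S n W s \<and> set gs \<subseteq> W"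
    using app.IH
  proof (induction gs)
    case Nil
    then show ?case using circuit.inputs by auto
  next
    case (Cons g gs)
    then obtain W s W' s' where "circuit S n W s" "g \<in> W" "circuit S n W' s'" "set gs \<subseteq> W'"
      by auto
    then show ?case using circuit_Un[of S n W s W' s'] by (intro exI[of _ "W \<union> W'"] exI[of _ "s + s'"]) auto
  qed
  then show ?case using app circuit.gate by blast
qed

lemma circuit_finite_generators:
  "circuit S n W s \<Longrightarrow> \<exists>S0 \<subseteq> S. finite S0 \<and> circuit S0 n W s"
proof (induction rule: circuit.induct)
  case inputs
  then show ?case using circuit.inputs by blast
next
  case (gate W s f gs)
  then obtain S0 where S0: "S0 \<subseteq> S" "finite S0" "circuit S0 n W s" by blast
  have "circuit (insert f S0) n W s" using S0(3) by (rule circuit_mono) auto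
  then have "circuit (insert f S0) n (insert (composition n f gs) W) (Suc s)"
    by (rule circuit.gate) (use gate in auto)
  then show ?case using S0 gate by (intro exI[of _ "insert f S0"]) auto
qed

section \<open>Counting the functions computed by circuits on a finite set\<close>

text \<open>
  All sets of functions on \<open>X\<close> that arise at the nodes of circuits with at most \<open>s\<close> gates whose gates are taken
  from \<open>T\<close>, a finite set of gate tables. Keeping the sets with fewer gates makes the family increasing in \<open>s\<close>.
\<close>

fun traces :: "operation set \<Rightarrow> nat \<Rightarrow> nat list set \<Rightarrow> nat \<Rightarrow> (nat list \<Rightarrow> nat) set set" where
  "traces T n X 0 = {(\<lambda>i. \<lambda>x\<in>X. x ! i) ` {..<n}}"
| "traces T n X (Suc s) = traces T n X s \<union>
     (\<Union>W\<in>traces T n X s. \<Union>t\<in>T.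
        (\<lambda>ws. insert (\<lambda>x\<in>X. snd t (map (\<lambda>w. w x) ws)) W) ` {ws. set ws \<subseteq> W \<and> length ws = fst t})"

lemma traces_mono: "s \<le> k \<Longrightarrow> traces T n X s \<subseteq> traces T n X k"
  by (induction rule: dec_induct) auto

text \<open>
  A new gate is determined by its table and a list of at most \<open>r\<close> previous nodes, of which there are at most
  \<open>n + k\<close>.
\<close>

lemma card_traces:
  assumes "finite T" "\<forall>t\<in>T. fst t \<le> r"
  shows "s \<le> k \<Longrightarrow> finite (traces T n X s) \<and> card (traces T n X s) \<le> (1 + card T * Suc (n + k) ^ r) ^ s
           \<and> (\<forall>W\<in>traces T n X s. finite W \<and> card W \<le> n + s)"
proof (induction s)
  case 0
  have "card ((\<lambda>i. \<lambda>x\<in>X. x ! i) ` {..<n}) \<le> card {..<n}" by (rule card_image_le) simp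
  then show ?case by simp
next
  case (Suc s)
  let ?L = "traces T n X s"
  let ?q = "Suc (n + k) ^ r"
  define G where "G W t = (\<lambda>ws. insert (\<lambda>x\<in>X. snd t (map (\<lambda>w. w x) ws)) W) `
      {ws. set ws \<subseteq> W \<and> length ws = fst t}" for W :: "(nat list \<Rightarrow> nat) set" and t :: operation
  have L: "finite ?L" "card ?L \<le> (1 + card T * ?q) ^ s"
    and W: "\<And>W. W \<in> ?L \<Longrightarrow> finite W \<and> card W \<le> n + s"
    using Suc by auto
  have step: "traces T n X (Suc s) = ?L \<union> (\<Union>W\<in>?L. \<Union>t\<in>T. G W t)"
    by (simp add: G_def)
  have G: "finite (G W t) \<and> card (G W t) \<le> ?q" if "W \<in> ?L" "t \<in> T" for W t
  proof -
    have fin: "finite {ws. set ws \<subseteq> W \<and> length ws = fst t}"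
      using W[OF that(1)] by (intro finite_lists_length_eq) auto
    have "card (G W t) \<le> card {ws. set ws \<subseteq> W \<and> length ws = fst t}"
      unfolding G_def by (rule card_image_le[OF fin])
    also have "\<dots> = card W ^ fst t" using W[OF that(1)] by (intro card_lists_length_eq) auto
    also have "\<dots> \<le> Suc (n + k) ^ fst t" using W[OF that(1)] Suc.prems by (intro power_mono) auto
    also have "\<dots> \<le> ?q" using assms(2) that(2) by (intro power_increasing) auto
    finally show ?thesis using fin by (simp add: G_def)
  qed
  have inner: "card (\<Union>t\<in>T. G W t) \<le> card T * ?q" if "W \<in> ?L" for W
  proof -
    have "card (\<Union>t\<in>T. G W t) \<le> (\<Sum>t\<in>T. card (G W t))" by (rule card_UN_le[OF assms(1)])
    also have "\<dots> \<le> (\<Sum>t\<in>T. ?q)" using G[OF that] by (intro sum_mono) auto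
    finally show ?thesis by simp
  qed
  have "card (\<Union>W\<in>?L. \<Union>t\<in>T. G W t) \<le> (\<Sum>W\<in>?L. card (\<Union>t\<in>T. G W t))" by (rule card_UN_le[OF L(1)])
  also have "\<dots> \<le> (\<Sum>W\<in>?L. card T * ?q)" using inner by (intro sum_mono) auto
  finally have "card (traces T n X (Suc s)) \<le> card ?L + card ?L * (card T * ?q)"
    using card_Un_le[of ?L "\<Union>W\<in>?L. \<Union>t\<in>T. G W t"] unfolding step sum_constant of_nat_id
    by linarith
  also have "\<dots> = card ?L * (1 + card T * ?q)" by simp
  also have "\<dots> \<le> (1 + card T * ?q) ^ s * (1 + card T * ?q)" using L(2) by (rule mult_le_mono1)
  finally have c: "card (traces T n X (Suc s)) \<le> (1 + card T * ?q) ^ Suc s"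
    by (simp only: power_Suc mult.commute)
  have f: "finite (traces T n X (Suc s))" unfolding step using L(1) G assms(1) by blast
  have "finite W' \<and> card W' \<le> n + Suc s" if W': "W' \<in> traces T n X (Suc s)" for W'
  proof (cases "W' \<in> ?L")
    case True
    then show ?thesis using W by fastforce
  next
    case False
    then obtain V w where V: "V \<in> ?L" "W' = insert w V" using W' unfolding step by (auto simp: G_def)
    have "card (insert w V) \<le> Suc (card V)" using W[OF V(1)] by (simp add: card_insert_if)
    then show ?thesis using V W[OF V(1)] by auto
  qed
  then show ?case using c f by blast
qed

text \<open>
  The gate tables over \<open>{..<M}\<close>: all \<open>d\<close>-ary ones, together with the indicator functions of sets of at
  most \<open>e\<close> tuples of length \<open>d + 1\<close>. The latter are the sparse case: of all tables of this arity, of which there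
  are too many, only those with few nonzero entries are kept.
\<close>

definition tables :: "nat \<Rightarrow> nat \<Rightarrow> nat \<Rightarrow> operation set" where
  "tables d M e = {d} \<times> (tuples {..<M} d \<rightarrow>\<^sub>E {..<M}) \<union>
     (\<lambda>Q. (Suc d, \<lambda>ys\<in>tuples {..<M} (Suc d). if ys \<in> Q then 1 else 0)) `
       {Q. Q \<subseteq> tuples {..<M} (Suc d) \<and> card Q \<le> e}"

text \<open>
  A set of at most \<open>e\<close> elements is enumerated by a list of length \<open>e\<close>, padded with \<^term>\<open>None\<close>.
\<close>

lemma card_small_subsets:
  assumes "finite A"
  shows "card {Q. Q \<subseteq> A \<and> card Q \<le> e} \<le> Suc (card A) ^ e"
proof -
  let ?A = "insert None (Some ` A)"
  let ?L = "{zs. set zs \<subseteq> ?A \<and> length zs = e}"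
  have "{Q. Q \<subseteq> A \<and> card Q \<le> e} \<subseteq> (\<lambda>zs. {x. Some x \<in> set zs}) ` ?L"
  proof
    fix Q assume "Q \<in> {Q. Q \<subseteq> A \<and> card Q \<le> e}"
    then have Q: "Q \<subseteq> A" "card Q \<le> e" by auto
    obtain xs where xs: "set xs = Q" "length xs = card Q"
      using Q(1) assms finite_distinct_list[of Q] by (metis distinct_card finite_subset)
    let ?zs = "map Some xs @ replicate (e - card Q) None"
    have "?zs \<in> ?L" using xs Q by auto
    moreover have "{x. Some x \<in> set ?zs} = Q" using xs by auto
    ultimately show "Q \<in> (\<lambda>zs. {x. Some x \<in> set zs}) ` ?L" by blast
  qed
  moreover have "finite ?L" using assms by (intro finite_lists_length_eq) auto
  ultimately have "card {Q. Q \<subseteq> A \<and> card Q \<le> e} \<le> card ?L" by (rule surj_card_le[rotated])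
  also have "\<dots> = card ?A ^ e" using assms by (intro card_lists_length_eq) auto
  also have "card ?A = Suc (card A)"
    using assms by (subst card_insert_disjoint) (auto simp: card_image)
  finally show ?thesis .
qed

lemma tables_bounds:
  "finite (tables d M e) \<and> (\<forall>t\<in>tables d M e. fst t \<le> Suc d) \<and>
   card (tables d M e) \<le> M ^ (M ^ d) + Suc (M ^ Suc d) ^ e"
proof -
  let ?A = "tuples {..<M} (Suc d)"
  let ?I = "\<lambda>Q. (Suc d, \<lambda>ys\<in>?A. if ys \<in> Q then 1 else (0::nat))"
  let ?P = "{Q. Q \<subseteq> ?A \<and> card Q \<le> e}"
  let ?D = "{d} \<times> (tuples {..<M} d \<rightarrow>\<^sub>E {..<M})"
  have A: "finite ?A" by (simp add: finite_tuples)
  have P: "finite ?P" using A by simp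
  have "card ?D = M ^ (M ^ d)"
    by (simp add: card_cartesian_product card_PiE finite_tuples card_tuples)
  moreover have "card (?I ` ?P) \<le> Suc (M ^ Suc d) ^ e"
    using card_image_le[OF P, of ?I] card_small_subsets[OF A, of e] by (simp add: card_tuples)
  ultimately have "card (tables d M e) \<le> M ^ (M ^ d) + Suc (M ^ Suc d) ^ e"
    unfolding tables_def using card_Un_le[of ?D "?I ` ?P"] by linarith
  moreover have "finite (tables d M e)"
    unfolding tables_def using P by (intro finite_UnI finite_cartesian_product finite_PiE finite_imageI) (auto simp: finite_tuples)
  ultimately show ?thesis by (auto simp: tables_def)
qed

text \<open>
  The operation \<open>f\<close>, restricted to \<open>Z\<close> and carried over to \<open>{..<M}\<close> along an injection \<open>\<phi>\<close> of \<open>Z\<close>. Where \<open>f\<close> leaves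
  \<open>Z\<close>, and off the image of \<open>Z\<close>, the value is 0, so that transferring a sparse two-valued operation yields
  a sparse table again.
\<close>

definition transfer :: "nat set \<Rightarrow> (nat \<Rightarrow> nat) \<Rightarrow> nat \<Rightarrow> operation \<Rightarrow> operation" where
  "transfer Z \<phi> M f = (fst f, \<lambda>ys\<in>tuples {..<M} (fst f).
     let r = snd f (map (inv_into Z \<phi>) ys) in if set ys \<subseteq> \<phi> ` Z \<and> r \<in> Z then \<phi> r else 0)"

lemma transfer_eval:
  assumes "inj_on \<phi> Z" "\<phi> ` Z \<subseteq> {..<M}" "length zs = fst f" "set zs \<subseteq> Z" "snd f zs \<in> Z"
  shows "snd (transfer Z \<phi> M f) (map \<phi> zs) = \<phi> (snd f zs)"
proof -
  have "map (inv_into Z \<phi>) (map \<phi> zs) = zs"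
    using assms(1,4) by (auto simp: inv_into_f_f subset_iff intro: map_idI)
  moreover have "map \<phi> zs \<in> tuples {..<M} (fst f)" using assms by (auto simp: mem_tuples_iff)
  moreover have "set (map \<phi> zs) \<subseteq> \<phi> ` Z" using assms(4) by auto
  ultimately show ?thesis using assms(5) unfolding transfer_def Let_def by simp
qed

text \<open>
  If all node values on inputs below \<open>N\<close> lie in \<open>Z\<close>, renaming them by \<open>\<phi>\<close> commutes with every gate.
  As \<open>\<phi>\<close> fixes the inputs, the renamed node functions are those of a circuit built from the transferred
  generators.
\<close>

lemma circuit_traces:
  assumes "circuit S n W s" "\<forall>u\<in>W. op_image u {..<N} \<subseteq> Z"
    and \<phi>: "inj_on \<phi> Z" "\<phi> ` Z \<subseteq> {..<M}" "{..<N} \<subseteq> Z" "\<And>x. x < N \<Longrightarrow> \<phi> x = x"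
    and T: "\<forall>f\<in>S. transfer Z \<phi> M f \<in> T"
  shows "(\<lambda>u. \<lambda>x\<in>tuples {..<N} n. \<phi> (snd u x)) ` W \<in> traces T n (tuples {..<N} n) s"
  using assms(1,2)
proof induction
  case inputs
  have "(\<lambda>x\<in>tuples {..<N} n. \<phi> (snd (projection n i) x)) = (\<lambda>x\<in>tuples {..<N} n. x ! i)"
    if "i < n" for i
    using that by (intro restrict_ext) (auto simp: mem_tuples_iff snd_projection subset_iff intro!: \<phi>(4))
  then have "(\<lambda>u. \<lambda>x\<in>tuples {..<N} n. \<phi> (snd u x)) ` projection n ` {..<n}
      = (\<lambda>i. \<lambda>x\<in>tuples {..<N} n. x ! i) ` {..<n}"
    unfolding image_image by (intro image_cong) auto
  then show ?case by (simp only: traces.simps singleton_iff)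
next
  case (gate W s f gs)
  let ?X = "tuples {..<N} n"
  let ?r = "\<lambda>u. \<lambda>x\<in>?X. \<phi> (snd u x)"
  have nary: "u \<in> nary_operations n" if "u \<in> W" for u
    using circuit_subset[OF gate.hyps(1)] that term_ops_nary by blast
  have in_Z: "snd u x \<in> Z" if "u \<in> insert (composition n f gs) W" "x \<in> ?X" for u x
  proof -
    have "u \<in> nary_operations n" using that(1) nary composition_nary by blast
    then have "fst u = n" by (simp add: nary_operations_iff)
    then have "snd u x \<in> op_image u {..<N}" using that(2) by (simp add: op_image_def)
    then show ?thesis using gate.prems that(1) by blast
  qed
  have "?r (composition n f gs) = (\<lambda>x\<in>?X. snd (transfer Z \<phi> M f) (map (\<lambda>w. w x) (map ?r gs)))"
  proof (rule restrict_ext)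
    fix x assume x: "x \<in> ?X"
    have l: "length x = n" using x by (simp add: mem_tuples_iff)
    have z: "set (map (\<lambda>g. snd g x) gs) \<subseteq> Z" using in_Z x gate.hyps by auto
    have c: "snd (composition n f gs) x = snd f (map (\<lambda>g. snd g x) gs)" using l by (rule snd_composition)
    have r: "map (\<lambda>w. w x) (map ?r gs) = map \<phi> (map (\<lambda>g. snd g x) gs)" using x by simp
    have t: "snd (transfer Z \<phi> M f) (map \<phi> (map (\<lambda>g. snd g x) gs)) = \<phi> (snd f (map (\<lambda>g. snd g x) gs))"
      using transfer_eval[OF \<phi>(1,2) _ z, of f] gate.hyps in_Z[OF _ x, of "composition n f gs"] c by simp
    show "\<phi> (snd (composition n f gs) x) = snd (transfer Z \<phi> M f) (map (\<lambda>w. w x) (map ?r gs))"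
      unfolding r t c by (rule refl)
  qed
  moreover have "\<forall>u\<in>W. op_image u {..<N} \<subseteq> Z" using gate.prems by blast
  then have rW: "?r ` W \<in> traces T n ?X s" by (rule gate.IH)
  moreover have "set (map ?r gs) \<subseteq> ?r ` W" "length (map ?r gs) = fst (transfer Z \<phi> M f)"
    using gate.hyps by (auto simp: transfer_def)
  ultimately have step: "?r ` insert (composition n f gs) W \<in>
     (\<lambda>ws. insert (\<lambda>x\<in>?X. snd (transfer Z \<phi> M f) (map (\<lambda>w. w x) ws)) (?r ` W)) `
      {ws. set ws \<subseteq> ?r ` W \<and> length ws = fst (transfer Z \<phi> M f)}"
    by (intro image_eqI[of _ _ "map ?r gs"]) auto
  have tT: "transfer Z \<phi> M f \<in> T" using T gate.hyps(2) by blast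
  show ?case unfolding traces.simps by (rule UnI2, rule UN_I[OF rW], rule UN_I[OF tT], rule step)
qed

lemma transfer_in_tables_arbitrary:
  assumes "fst f = d" "\<phi> ` Z \<subseteq> {..<M}" "M > 0"
  shows "transfer Z \<phi> M f \<in> tables d M e"
proof -
  have "\<phi> r < M" if "r \<in> Z" for r using assms(2) that by blast
  then have "transfer Z \<phi> M f \<in> {d} \<times> (tuples {..<M} d \<rightarrow>\<^sub>E {..<M})"
    using assms(1,3) by (simp add: transfer_def Let_def restrict_PiE_iff)
  then show ?thesis by (simp add: tables_def)
qed

text \<open>
  Because \<open>\<phi>\<close> fixes 0 and 1, the transferred operation is again two-valued, and \<open>\<phi>\<close> maps the tuples where \<open>f\<close> is
  1 onto those where its transfer is 1.
\<close>

lemma transfer_in_tables_sparse: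
  assumes f: "fst f = Suc d" "two_valued f" and Z: "finite Z" "{0, 1} \<subseteq> Z"
    and \<phi>: "inj_on \<phi> Z" "\<phi> ` Z \<subseteq> {..<M}" "\<phi> 0 = 0" "\<phi> 1 = 1"
    and e: "card {zs \<in> tuples Z (Suc d). snd f zs = 1} \<le> e"
  shows "transfer Z \<phi> M f \<in> tables d M e"
proof -
  let ?A = "tuples {..<M} (Suc d)"
  let ?R = "{zs \<in> tuples Z (Suc d). snd f zs = 1}"
  define Q where "Q = map \<phi> ` ?R"
  have "card Q \<le> e" unfolding Q_def using card_image_le[of ?R "map \<phi>"] e Z(1) by (simp add: finite_tuples)
  moreover have "Q \<subseteq> ?A"
  proof -
    have "map \<phi> zs \<in> ?A" if "zs \<in> tuples Z (Suc d)" for zs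
      using that \<phi>(2) unfolding mem_tuples_iff set_map length_map by blast
    then show ?thesis unfolding Q_def by blast
  qed
  moreover have "transfer Z \<phi> M f = (Suc d, \<lambda>ys\<in>?A. if ys \<in> Q then 1 else 0)"
    unfolding transfer_def f(1) Let_def
  proof (intro arg_cong2[of _ _ _ _ Pair] refl restrict_ext)
    fix ys assume ys: "ys \<in> ?A"
    show "(if set ys \<subseteq> \<phi> ` Z \<and> snd f (map (inv_into Z \<phi>) ys) \<in> Z then \<phi> (snd f (map (inv_into Z \<phi>) ys)) else 0)
        = (if ys \<in> Q then 1 else 0)"
    proof (cases "set ys \<subseteq> \<phi> ` Z")
      case True
      define zs where "zs = map (inv_into Z \<phi>) ys"
      have yz: "map \<phi> zs = ys" unfolding zs_def using True by (auto simp: f_inv_into_f subset_iff intro: map_idI)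
      have zs: "zs \<in> tuples Z (Suc d)" using ys True inv_into_into[of _ \<phi> Z] by (auto simp: zs_def mem_tuples_iff)
      have "snd f zs \<in> {0, 1}" using f zs by (simp add: two_valued_iff mem_tuples_iff)
      moreover have "ys \<in> Q \<longleftrightarrow> snd f zs = 1"
      proof
        assume "ys \<in> Q"
        then obtain zs' where zs': "zs' \<in> ?R" "map \<phi> zs' = ys" by (auto simp: Q_def)
        then have "zs' = zs" using yz zs map_inj_on[of \<phi> zs' zs] inj_on_subset[OF \<phi>(1)]
          by (auto simp: mem_tuples_iff)
        then show "snd f zs = 1" using zs' by simp
      qed (use yz zs in \<open>auto simp: Q_def\<close>)
      ultimately show ?thesis using True Z(2) \<phi>(3,4) by (auto simp flip: zs_def)
    next
      case False
      have "ys \<notin> Q"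
      proof
        assume "ys \<in> Q"
        then obtain zs where "zs \<in> tuples Z (Suc d)" "ys = map \<phi> zs" by (auto simp: Q_def)
        then have "set ys \<subseteq> \<phi> ` Z" by (simp add: mem_tuples_iff image_mono)
        with False show False by simp
      qed
      then show ?thesis using False by simp
    qed
  qed
  ultimately show ?thesis unfolding tables_def by blast
qed

lemma renaming_exists:
  assumes "finite Z" "{..<N} \<subseteq> Z" "card Z \<le> M"
  shows "\<exists>\<phi>. inj_on \<phi> Z \<and> \<phi> ` Z \<subseteq> {..<M} \<and> (\<forall>x<N. \<phi> x = x)"
proof -
  have NM: "N \<le> M" using card_mono[OF assms(1,2)] assms(3) by simp
  have "card (Z - {..<N}) \<le> card {N..<M}" using assms by (simp add: card_Diff_subset)
  then obtain \<psi> where \<psi>: "\<psi> ` (Z - {..<N}) \<subseteq> {N..<M}" "inj_on \<psi> (Z - {..<N})"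
    using card_le_inj[of "Z - {..<N}" "{N..<M}"] assms(1) by auto
  define \<phi> where "\<phi> x = (if x < N then x else \<psi> x)" for x
  have big: "N \<le> \<psi> x \<and> \<psi> x < M" if "x \<in> Z" "\<not> x < N" for x using \<psi>(1) that by auto
  have "inj_on \<phi> Z"
  proof (rule inj_onI)
    fix x y assume "x \<in> Z" "y \<in> Z" "\<phi> x = \<phi> y"
    then show "x = y" using big[of x] big[of y] \<psi>(2) by (auto simp: \<phi>_def inj_on_def split: if_splits)
  qed
  moreover have "\<phi> ` Z \<subseteq> {..<M}" using big NM by (auto simp: \<phi>_def)
  ultimately show ?thesis by (intro exI[of _ \<phi>]) (auto simp: \<phi>_def)
qed

section \<open>Locally sparse graphs with many edges\<close>

text \<open>
  For a symmetric relation without loops, which counts each edge twice, the condition says that every nonempty set of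
  at most \<open>L\<close> vertices spans fewer edges than it has vertices, as in a forest.
\<close>

definition sparse_upto :: "nat \<Rightarrow> ('a \<times> 'a) set \<Rightarrow> bool" where
  "sparse_upto L H \<longleftrightarrow>
     (\<forall>Z. finite Z \<and> Z \<noteq> {} \<and> card Z \<le> L \<longrightarrow> card (H \<inter> Z \<times> Z) + 2 \<le> 2 * card Z)"

lemma card_relpow_Image:
  fixes H :: "('a \<times> 'a) set"
  assumes "finite H" "\<And>x. card (H `` {x}) \<le> D"
  shows "finite ((H ^^ n) `` {u}) \<and> card ((H ^^ n) `` {u}) \<le> D ^ n"
proof (induction n)
  case 0
  have "(H ^^ 0) `` {u} = {u}" by auto
  then show ?case by simp
next
  case (Suc n)
  have eq: "(H ^^ Suc n) `` {u} = (\<Union>x\<in>(H ^^ n) `` {u}. H `` {x})" by (auto simp: relcomp_unfold)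
  have "card (\<Union>x\<in>(H ^^ n) `` {u}. H `` {x}) \<le> (\<Sum>x\<in>(H ^^ n) `` {u}. card (H `` {x}))"
    using Suc by (intro card_UN_le) auto
  also have "\<dots> \<le> card ((H ^^ n) `` {u}) * D" using sum_bounded_above[of _ "\<lambda>x. card (H `` {x})" D, OF assms(2)] by simp
  also have "\<dots> \<le> D ^ n * D" using Suc by (intro mult_right_mono) auto
  finally show ?case unfolding eq using Suc assms(1) by (auto simp: finite_Image mult.commute)
qed

text \<open>
  Consider a small set \<open>Z\<close> containing the ends of the new edge. As \<open>v\<close> is far from \<open>u\<close>, it is not connected to \<open>u\<close>
  inside \<open>Z\<close>. Splitting off the component \<open>P\<close> of \<open>u\<close> in \<open>Z\<close> and using sparsity for both parts saves 2 more pairs than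
  using it for \<open>Z\<close>, which pays for the two orientations of the new edge.
\<close>

lemma sparse_upto_insert:
  assumes H: "finite H" "sym H" "sparse_upto L H" "u \<noteq> v"
    and far: "\<And>n. n \<le> 2 * L \<Longrightarrow> (u, v) \<notin> H ^^ n"
  shows "sparse_upto L (insert (u, v) (insert (v, u) H))"
  unfolding sparse_upto_def
proof (intro allI impI, elim conjE)
  fix Z :: "'a set"
  assume Z: "finite Z" "Z \<noteq> {}" "card Z \<le> L"
  let ?R = "H \<inter> Z \<times> Z"
  have R: "card ?R + 2 \<le> 2 * card Z" using H(3) Z by (auto simp: sparse_upto_def)
  show "card (insert (u, v) (insert (v, u) H) \<inter> Z \<times> Z) + 2 \<le> 2 * card Z"
  proof (cases "u \<in> Z \<and> v \<in> Z")
    case False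
    then have "insert (u, v) (insert (v, u) H) \<inter> Z \<times> Z = ?R" by auto
    then show ?thesis using R by simp
  next
    case True
    define P where "P = {z \<in> Z. (u, z) \<in> ?R\<^sup>*}"
    have fR: "finite ?R" using H(1) by simp
    have "v \<notin> P"
    proof
      assume "v \<in> P"
      then have "(u, v) \<in> ?R\<^sup>*" by (simp add: P_def)
      then obtain n where n: "n \<le> card ?R" "(u, v) \<in> ?R ^^ n"
        using rtrancl_finite_eq_relpow[OF fR] by auto
      have "?R ^^ n \<subseteq> H ^^ n" by (induction n) auto
      moreover have "n \<le> 2 * L" using n(1) R Z(3) by linarith
      ultimately show False using far n(2) by blast
    qed
    have "u \<in> P" using True by (simp add: P_def)
    have closed: "b \<in> P" if "a \<in> P" "(a, b) \<in> H" "b \<in> Z" for a b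
      using that by (auto simp: P_def intro: rtrancl.rtrancl_into_rtrancl)
    have "?R = H \<inter> P \<times> P \<union> H \<inter> (Z - P) \<times> (Z - P)"
      using closed \<open>sym H\<close> by (auto simp: P_def dest: symD)
    then have "card ?R \<le> card (H \<inter> P \<times> P) + card (H \<inter> (Z - P) \<times> (Z - P))"
      by (metis card_Un_le)
    moreover have "card (H \<inter> P \<times> P) + 2 \<le> 2 * card P"
    proof -
      have "P \<subseteq> Z" by (auto simp: P_def)
      then have "finite P" "card P \<le> L" using Z card_mono[of Z P] finite_subset by auto
      then show ?thesis using H(3) \<open>u \<in> P\<close> unfolding sparse_upto_def by blast
    qed
    moreover have "card (H \<inter> (Z - P) \<times> (Z - P)) + 2 \<le> 2 * card (Z - P)"
    proof -
      have "Z - P \<noteq> {}" using True \<open>v \<notin> P\<close> by blast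
      moreover have "card (Z - P) \<le> L" using Z card_mono[of Z "Z - P"] by auto
      ultimately show ?thesis using H(3) Z(1) unfolding sparse_upto_def by blast
    qed
    moreover have "card Z = card P + card (Z - P)"
      using Z(1) card_Diff_subset[of P Z] card_mono[of Z P] finite_subset[of P Z] by (auto simp: P_def)
    ultimately have "card ?R + 4 \<le> 2 * card Z" by linarith
    moreover have "insert (u, v) (insert (v, u) H) \<inter> Z \<times> Z \<subseteq> insert (u, v) (insert (v, u) ?R)" by auto
    then have "card (insert (u, v) (insert (v, u) H) \<inter> Z \<times> Z) \<le> card (insert (u, v) (insert (v, u) ?R))"
      using fR by (intro card_mono) auto
    moreover have "card (insert (u, v) (insert (v, u) ?R)) \<le> card ?R + 2"
      using card_insert_le_m1[of "Suc (card ?R)" ?R "(v, u)"] card_insert_le_m1[of "card ?R + 2" "insert (v, u) ?R" "(u, v)"] by simp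
    ultimately show ?thesis by linarith
  qed
qed

text \<open>
  Take a graph with as many edges as possible among the sparse graphs of maximal degree at most \<open>D\<close>. By
  \<open>sparse_upto_insert\<close> any two vertices of degree less than \<open>D\<close> are at distance at most \<open>2 * L\<close>, as otherwise they could
  be joined. So all such vertices lie in one ball, whose size does not depend on \<open>V\<close>, and all other vertices have
  degree \<open>D\<close>.
\<close>

lemma sparse_graph_greedy:
  fixes V :: "'a set"
  assumes V: "finite V" and "L \<ge> 1" "D \<ge> 1"
  shows "\<exists>H \<subseteq> V \<times> V. sparse_upto L H \<and> D * (card V - (2 * L + 1) * D ^ (2 * L)) \<le> card H"
proof -
  define good where "good H \<longleftrightarrow> H \<subseteq> V \<times> V \<and> sym H \<and> sparse_upto L H \<and> (\<forall>x. card (H `` {x}) \<le> D)"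
    for H
  have "card ({} \<inter> Z \<times> Z) + 2 \<le> 2 * card Z" if "finite Z" "Z \<noteq> {}" for Z :: "'a set"
  proof -
    have "card Z > 0" using that by (simp add: card_gt_0_iff)
    then show ?thesis by simp
  qed
  then have "sparse_upto L ({} :: ('a \<times> 'a) set)" unfolding sparse_upto_def by blast
  then have "good {}" by (simp add: good_def sym_def)
  moreover have bdd: "\<forall>H. good H \<longrightarrow> card H < Suc (card (V \<times> V))"
  proof (intro allI impI)
    fix H assume "good H"
    then have "H \<subseteq> V \<times> V" by (simp add: good_def)
    then have "card H \<le> card (V \<times> V)" using V by (intro card_mono) auto
    then show "card H < Suc (card (V \<times> V))" by (rule le_imp_less_Suc)
  qed
  ultimately obtain H where H: "good H" and max: "\<And>H'. good H' \<Longrightarrow> card H' \<le> card H"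
    using ex_has_greatest_nat[of good "{}" card] by blast
  have HV: "H \<subseteq> V \<times> V" "sym H" "sparse_upto L H" and deg: "\<And>x. card (H `` {x}) \<le> D"
    using H by (auto simp: good_def)
  have fH: "finite H" using HV(1) V finite_subset by blast
  define low where "low = {x \<in> V. card (H `` {x}) < D}"
  let ?c = "(2 * L + 1) * D ^ (2 * L)"
  have "card low \<le> ?c"
  proof (cases "low = {}")
    case False
    then obtain u where u: "u \<in> low" by blast
    let ?ball = "\<Union>n\<in>{..2 * L}. (H ^^ n) `` {u}"
    have "v \<in> ?ball" if v: "v \<in> low" for v
    proof (rule ccontr)
      assume nb: "v \<notin> ?ball"
      then have far: "\<And>n. n \<le> 2 * L \<Longrightarrow> (u, v) \<notin> H ^^ n" by auto
      have uv: "u \<noteq> v" using far[of 0] by auto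
      have nH: "(u, v) \<notin> H" using far[of 1] assms(2) by auto
      let ?H = "insert (u, v) (insert (v, u) H)"
      have "card (?H `` {x}) \<le> D" for x
      proof -
        consider "x = u" | "x = v" | "x \<noteq> u" "x \<noteq> v" by blast
        then show ?thesis
        proof cases
          case 1
          then have "?H `` {x} = insert v (H `` {x})" using uv by auto
          then show ?thesis using 1 u fH by (auto simp: low_def card_insert_if finite_Image)
        next
          case 2
          then have "?H `` {x} = insert u (H `` {x})" using uv by auto
          then show ?thesis using 2 v fH by (auto simp: low_def card_insert_if finite_Image)
        next
          case 3
          then have "?H `` {x} = H `` {x}" by auto
          then show ?thesis using deg by simp
        qed
      qed
      moreover have "sym ?H" using HV(2) by (auto simp: sym_def)
      moreover have "?H \<subseteq> V \<times> V" using HV(1) u v by (auto simp: low_def)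
      ultimately have "good ?H"
        using sparse_upto_insert[OF fH HV(2,3) uv far] by (simp add: good_def)
      then have "card ?H \<le> card H" by (rule max)
      moreover have "card H < card ?H"
        using nH fH by (intro psubset_card_mono) auto
      ultimately show False by simp
    qed
    then have "card low \<le> card ?ball"
      using card_relpow_Image[OF fH deg] by (intro card_mono) auto
    also have "\<dots> \<le> (\<Sum>n\<in>{..2 * L}. card ((H ^^ n) `` {u}))" by (rule card_UN_le) simp
    also have "\<dots> \<le> (\<Sum>n\<in>{..2 * L}. D ^ (2 * L))"
    proof (rule sum_mono)
      fix n assume "n \<in> {..2 * L}"
      then have "D ^ n \<le> D ^ (2 * L)" using assms(3) by (intro power_increasing) auto
      then show "card ((H ^^ n) `` {u}) \<le> D ^ (2 * L)"
        using card_relpow_Image[OF fH deg, of n u] by linarith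
    qed
    finally show ?thesis by simp
  qed simp
  have "low \<subseteq> V" by (auto simp: low_def)
  then have "card V - ?c \<le> card (V - low)"
    using \<open>card low \<le> ?c\<close> V by (simp add: card_Diff_subset finite_subset)
  then have "D * (card V - ?c) \<le> (\<Sum>x\<in>V - low. D)" by simp
  also have "\<dots> \<le> (\<Sum>x\<in>V - low. card (H `` {x}))"
    by (intro sum_mono) (auto simp: low_def not_less)
  also have "\<dots> \<le> (\<Sum>x\<in>V. card (H `` {x}))" using V by (intro sum_mono2) auto
  also have "\<dots> = card (SIGMA x:V. H `` {x})" using V fH by (simp add: finite_Image)
  also have "(SIGMA x:V. H `` {x}) = H" using HV(1) by auto
  finally show ?thesis using HV by blast
qed

lemma linear_less_power2: "\<exists>t::nat. p + q * t < 2 ^ t"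
proof -
  let ?r = "p + 2 * q"
  have r: "?r + 1 \<le> 2 ^ ?r" by (metis Suc_eq_plus1 Suc_leI less_exp)
  have "(?r + 1) * (?r + 1) \<le> 2 ^ ?r * 2 ^ ?r" by (rule mult_le_mono[OF r r])
  also have "\<dots> = 2 ^ (2 * ?r)" by (metis mult_2 power_add)
  finally have "(?r + 1) * (?r + 1) \<le> 2 ^ (2 * ?r)" .
  moreover have "p + q * (2 * ?r) < (?r + 1) * (?r + 1)" by (simp add: algebra_simps)
  ultimately have "p + q * (2 * ?r) < 2 ^ (2 * ?r)" by (rule less_le_trans[rotated])
  then show ?thesis by blast
qed

text \<open>
  The number of vertices can be kept polynomial in the degree \<open>D\<close>, so its logarithm is negligible against
  \<open>D\<close>. This makes the number of edges, about \<open>N * D\<close>, exceed every constant multiple of \<open>N * log N\<close>.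
\<close>

lemma sparse_graph_exists:
  fixes a K L :: nat
  shows "\<exists>N H. b \<le> N \<and> H \<subseteq> {a..<N} \<times> {a..<N} \<and> sparse_upto L H \<and> (K * N) ^ (K * N) < 2 ^ card H"
proof -
  \<comment> \<open>The greedy construction needs a positive bound.\<close>
  define l where "l = Suc L"
  define E where "E = (K + 1) * (2 * (a + b) + 4 * l + 2)"
  obtain t where t: "4 * (K + 1) * E + 8 * (K + 1) * l * t < 2 ^ t"
    using linear_less_power2 by blast
  define D :: nat where "D = 2 ^ t"
  define c where "c = (2 * l + 1) * D ^ (2 * l)"
  \<comment> \<open>Twice the size of the ball of low degree vertices, so that at least half of all vertices have full degree.\<close>
  define n where "n = 2 * c + a + b"
  define N where "N = a + n"
  have D1: "D \<ge> 1" by (simp add: D_def)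
  obtain H where H: "H \<subseteq> {a..<N} \<times> {a..<N}" "sparse_upto l H"
    and card: "D * (card {a..<N} - c) \<le> card H"
    using sparse_graph_greedy[of "{a..<N}" l D] D1 unfolding c_def by (auto simp: l_def)
  have sp: "sparse_upto L H" using H(2) by (auto simp: sparse_upto_def l_def)
  have "N \<le> 4 * (card {a..<N} - c)" by (simp add: N_def n_def)
  then have "D * N \<le> 4 * (D * (card {a..<N} - c))" by simp
  then have DN: "D * N \<le> 4 * card H" using card by linarith
  have "c \<ge> 1" by (simp add: c_def D_def Suc_le_eq)
  then have N1: "N \<ge> 1" by (simp add: N_def n_def)
  have "(K + 1) * N \<le> E * D ^ (2 * l)"
  proof -
    have "N \<le> 2 * (a + b) * D ^ (2 * l) + 2 * c"
    proof -
      have "1 \<le> D ^ (2 * l)" using D1 by simp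
      then have "2 * (a + b) * 1 \<le> 2 * (a + b) * D ^ (2 * l)" by (rule mult_le_mono2)
      moreover have "N \<le> 2 * (a + b) * 1 + 2 * c" by (simp add: N_def n_def)
      ultimately show ?thesis by (meson add_le_mono1 le_trans)
    qed
    also have "\<dots> = (2 * (a + b) + 4 * l + 2) * D ^ (2 * l)"
      by (simp add: c_def algebra_simps)
    finally show ?thesis unfolding E_def by (metis mult_le_mono2 mult.assoc)
  qed
  also have "\<dots> \<le> 2 ^ E * 2 ^ (2 * l * t)"
    
  proof (rule mult_mono)
    show "E \<le> 2 ^ E" using less_exp[of E] by (rule less_imp_le)
    have "D ^ (2 * l) = 2 ^ (t * (2 * l))" unfolding D_def by (rule power_mult[symmetric])
    then show "D ^ (2 * l) \<le> 2 ^ (2 * l * t)" by (simp only: mult.commute order_refl)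
  qed simp_all
  finally have KN: "(K + 1) * N \<le> 2 ^ (E + 2 * l * t)" by (simp add: power_add)
  have "(K * N) ^ (K * N) \<le> ((K + 1) * N) ^ (K * N)" by (intro power_mono) auto
  also have "\<dots> \<le> ((K + 1) * N) ^ ((K + 1) * N)" using N1 by (intro power_increasing) auto
  also have "\<dots> \<le> (2 ^ (E + 2 * l * t)) ^ ((K + 1) * N)" using KN by (rule power_mono) simp
  also have "\<dots> = 2 ^ ((E + 2 * l * t) * ((K + 1) * N))" by (simp add: power_mult)
  also have "\<dots> < 2 ^ card H"
  proof (rule power_strict_increasing)
    have "4 * ((E + 2 * l * t) * ((K + 1) * N)) = (4 * (K + 1) * E + 8 * (K + 1) * l * t) * N"
      by (simp add: algebra_simps)
    also have "\<dots> < D * N" using t N1 by (simp add: D_def)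
    finally show "(E + 2 * l * t) * ((K + 1) * N) < card H" using DN by linarith
  qed simp
  finally have "(K * N) ^ (K * N) < 2 ^ card H" .
  then show ?thesis using H(1) sp by (intro exI[of _ N] exI[of _ H]) (auto simp: N_def n_def)
qed

section \<open>Sets of tuples that small circuits cannot compute\<close>

text \<open>
  Adding \<open>d - 1\<close> free coordinates multiplies all edge counts by the same power of the number of vertices. It turns the
  comparison of a graph with \<open>n * log n\<close> into one with \<open>n ^ d * log n\<close>, for sets of tuples of length \<open>d + 1\<close>.
\<close>

definition hyperedges :: "nat \<Rightarrow> nat set \<Rightarrow> (nat \<times> nat) set \<Rightarrow> nat list set" where
  "hyperedges d Z H = (\<lambda>(xs, u, v). xs @ [u, v]) ` (tuples Z (d - 1) \<times> H)"

lemma card_hyperedges: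
  assumes "finite Z" "finite H"
  shows "finite (hyperedges d Z H)" "card (hyperedges d Z H) = card Z ^ (d - 1) * card H"
proof -
  have "inj_on (\<lambda>(xs, u, v). xs @ [u, v]) (tuples Z (d - 1) \<times> H)" by (auto simp: inj_on_def)
  then show "card (hyperedges d Z H) = card Z ^ (d - 1) * card H"
    using assms by (simp add: hyperedges_def card_image card_cartesian_product card_tuples)
  show "finite (hyperedges d Z H)" using assms by (simp add: hyperedges_def finite_tuples)
qed

lemma hyperedges_tuples:
  assumes "d \<ge> 1" "H \<subseteq> Z \<times> Z" shows "hyperedges d Z H \<subseteq> tuples Z (Suc d)"
  using assms by (auto simp: hyperedges_def mem_tuples_iff)

text \<open>
  One stage of the construction, living between \<open>a\<close> and \<open>N\<close>: the set \<open>E\<close> of tuples is computed by no circuit with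
  \<open>k\<close> gates, all of them \<open>d\<close>-ary or sparse, whose values on inputs below \<open>N\<close> fill at most \<open>k * N\<close> places, whereas sets of size at most \<open>k * a\<close>, which
  are those relevant to the earlier stages, span few edges of \<open>H\<close>. The condition \<open>a * a \<le> N\<close> makes all earlier stages
  together negligible.
\<close>

definition level :: "nat \<Rightarrow> nat \<Rightarrow> nat \<Rightarrow> nat \<Rightarrow> (nat \<times> nat) set \<Rightarrow> nat list set \<Rightarrow> bool" where
  "level d k a N H E \<longleftrightarrow>
     a \<le> N \<and> a * a \<le> N \<and> 2 \<le> N \<and> k \<le> N \<and>
     H \<subseteq> {a..<N} \<times> {a..<N} \<and> sparse_upto (k * a) H \<and> E \<subseteq> hyperedges d {..<N} H \<and>
     (\<forall>W\<in>traces (tables d (k * N) (3 * (k * N) ^ d)) (Suc d) (tuples {..<N} (Suc d)) k.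
        \<forall>w\<in>W. E \<noteq> {x \<in> hyperedges d {..<N} H. w x = 1})"

text \<open>
  The bound of \<open>card_traces\<close> with the factors and summands absorbed generously into the exponent; only its form, a power of
  \<open>M\<close> with exponent a constant times \<open>M ^ d\<close>, matters.
\<close>

lemma card_traces_tables:
  fixes d M k :: nat
  assumes "k + d + 2 \<le> M"
  defines "T \<equiv> tables d M (3 * M ^ d)"
  shows "finite (\<Union> (traces T (Suc d) X k))"
    and "card (\<Union> (traces T (Suc d) X k)) \<le> M ^ ((k * (4 * d + 9) + 1) * M ^ d)"
proof -
  have M2: "M \<ge> 2" using assms by simp
  let ?m = "M ^ d"
  have m1: "?m \<ge> 1" using M2 by simp
  have T: "finite T" "\<forall>t\<in>T. fst t \<le> Suc d" "card T \<le> M ^ ?m + Suc (M ^ Suc d) ^ (3 * ?m)"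
    using tables_bounds[of d M "3 * M ^ d"] by (auto simp: T_def)
  let ?c = "3 * (d + 2)"
  have "Suc (M ^ Suc d) \<le> M ^ Suc d + M ^ Suc d" using M2 by simp
  also have "\<dots> = 2 * M ^ Suc d" by simp
  also have "\<dots> \<le> M * M ^ Suc d" using M2 by (rule mult_le_mono1)
  finally have "Suc (M ^ Suc d) \<le> M ^ (d + 2)" by simp
  then have "Suc (M ^ Suc d) ^ (3 * ?m) \<le> (M ^ (d + 2)) ^ (3 * ?m)" by (rule power_mono) simp
  also have "\<dots> = M ^ ((d + 2) * (3 * ?m))" by (rule power_mult[symmetric])
  also have "(d + 2) * (3 * ?m) = ?c * ?m" by (simp add: algebra_simps)
  finally have t1: "Suc (M ^ Suc d) ^ (3 * ?m) \<le> M ^ (?c * ?m)" .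
  have t2: "M ^ ?m \<le> M ^ (?c * ?m)" using M2 by (intro power_increasing) auto
  have "card T \<le> 2 * M ^ (?c * ?m)" using T(3) t1 t2 by linarith
  also have "\<dots> \<le> M * M ^ (?c * ?m)" using M2 by (rule mult_le_mono1)
  finally have cT: "card T \<le> M ^ (?c * ?m + 1)" by simp
  have "Suc (Suc d + k) ^ Suc d \<le> M ^ Suc d" using assms(1) by (intro power_mono) auto
  with cT have "card T * Suc (Suc d + k) ^ Suc d \<le> M ^ (?c * ?m + 1) * M ^ Suc d" by (rule mult_le_mono)
  then have "1 + card T * Suc (Suc d + k) ^ Suc d \<le> 2 * (M ^ (?c * ?m + 1) * M ^ Suc d)"
  proof -
    have "1 \<le> M ^ (?c * ?m + 1) * M ^ Suc d" using M2 by (simp only: power_add[symmetric] one_le_power)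
    then show ?thesis using \<open>card T * _ \<le> _\<close> by linarith
  qed
  also have "\<dots> \<le> M * (M ^ (?c * ?m + 1) * M ^ Suc d)" using M2 by (rule mult_le_mono1)
  also have "\<dots> = M ^ (?c * ?m + (d + 3))" 
  proof -
    have "?c * ?m + (d + 3) = Suc ((?c * ?m + 1) + Suc d)" by simp
    then show ?thesis by (simp only: power_Suc power_add)
  qed
  also have "\<dots> \<le> M ^ ((4 * d + 9) * ?m)"
  proof (rule power_increasing)
    have "(d + 3) * 1 \<le> (d + 3) * ?m" using m1 by (rule mult_le_mono2)
    then show "?c * ?m + (d + 3) \<le> (4 * d + 9) * ?m" by (simp add: algebra_simps)
  qed (use M2 in simp)
  finally have q: "1 + card T * Suc (Suc d + k) ^ Suc d \<le> M ^ ((4 * d + 9) * ?m)" .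
  let ?L = "traces T (Suc d) X k"
  have L: "finite ?L" "card ?L \<le> (1 + card T * Suc (Suc d + k) ^ Suc d) ^ k"
    and W: "\<And>W. W \<in> ?L \<Longrightarrow> finite W \<and> card W \<le> Suc d + k"
    using card_traces[OF T(1,2) order_refl] by blast+
  show "finite (\<Union> ?L)" using L(1) W by blast
  have "card (\<Union> ?L) \<le> (\<Sum>W\<in>?L. card W)" by (rule card_Union_le_sum_card)
  also have "\<dots> \<le> (\<Sum>W\<in>?L. M)" 
  proof (rule sum_mono)
    fix V assume "V \<in> ?L"
    then show "card V \<le> M" using W[of V] assms(1) by linarith
  qed
  also have "\<dots> = card ?L * M" by simp
  also have "\<dots> \<le> (M ^ ((4 * d + 9) * ?m)) ^ k * M"
    using L(2) q by (intro mult_le_mono1) (meson le_trans power_mono zero_le)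
  also have "\<dots> = M ^ ((4 * d + 9) * ?m * k + 1)" by (simp only: power_mult[symmetric] power_add power_one_right)
  also have "\<dots> \<le> M ^ ((k * (4 * d + 9) + 1) * ?m)" 
  proof (rule power_increasing)
    show "(4 * d + 9) * ?m * k + 1 \<le> (k * (4 * d + 9) + 1) * ?m" using m1 by (simp add: algebra_simps)
  qed (use M2 in simp)
  finally show "card (\<Union> ?L) \<le> M ^ ((k * (4 * d + 9) + 1) * ?m)" .
qed

text \<open>
  There are more sets of hyperedges than functions computed by the circuits, by the choice of a graph with
  sufficiently many edges.
\<close>

lemma level_exists:
  assumes "d \<ge> 1" "k \<ge> 1"
  shows "\<exists>N H E. level d k a N H E"
proof -
  define c where "c = k * (4 * d + 9) + 1"
  \<comment> \<open>The exponent of the counting bound is at most K * N * N ^ (d - 1), as M = k * N.\<close>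
  define K where "K = c * k ^ Suc d"
  obtain N H where N: "a + a * a + k + d + 2 \<le> N" and H: "H \<subseteq> {a..<N} \<times> {a..<N}" "sparse_upto (k * a) H"
    and big: "(K * N) ^ (K * N) < 2 ^ card H"
    using sparse_graph_exists[of "a + a * a + k + d + 2" a "k * a" K] by blast
  define M where "M = k * N"
  define T where "T = tables d M (3 * M ^ d)"
  let ?X = "tuples {..<N} (Suc d)"
  let ?hyp = "hyperedges d {..<N} H"
  let ?ws = "\<Union> (traces T (Suc d) ?X k)"
  have fH: "finite H" using H(1) finite_subset by blast
  have NM: "N \<le> M" using assms(2) by (simp add: M_def)
  have ws: "finite ?ws" "card ?ws \<le> M ^ (c * M ^ d)"
    using card_traces_tables[of k d M ?X] NM N unfolding c_def T_def by auto
  have "card ((\<lambda>w. {x \<in> ?hyp. w x = 1}) ` ?ws) \<le> card ?ws" by (rule card_image_le[OF ws(1)])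
  also note ws(2)
  also have "M ^ (c * M ^ d) \<le> (K * N) ^ (K * N * N ^ (d - 1))"
  proof -
    have c1: "c \<ge> 1" by (simp add: c_def)
    have "k * 1 \<le> k * (k ^ d * c)" using c1 assms(2) by (intro mult_le_mono2) simp
    then have MK: "M \<le> K * N" by (simp add: M_def K_def algebra_simps)
    have "N ^ d = N * N ^ (d - 1)" using assms(1) by (simp add: power_eq_if)
    then have "c * M ^ d = c * k ^ d * (N * N ^ (d - 1))" by (simp add: M_def power_mult_distrib)
    also have "\<dots> \<le> K * (N * N ^ (d - 1))" using assms(2) by (intro mult_le_mono1) (simp add: K_def)
    finally have "c * M ^ d \<le> K * N * N ^ (d - 1)" by (simp only: mult.assoc)
    then have "M ^ (c * M ^ d) \<le> M ^ (K * N * N ^ (d - 1))" using NM N by (intro power_increasing) auto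
    also have "\<dots> \<le> (K * N) ^ (K * N * N ^ (d - 1))" using MK by (rule power_mono) simp
    finally show ?thesis .
  qed
  also have "\<dots> = ((K * N) ^ (K * N)) ^ (N ^ (d - 1))" by (rule power_mult)
  also have "\<dots> < (2 ^ card H) ^ (N ^ (d - 1))"
    using big N by (intro power_strict_mono) auto
  also have "\<dots> = 2 ^ card ?hyp"
    using card_hyperedges[of "{..<N}" H d] fH by (simp add: power_mult[symmetric] mult.commute)
  also have "\<dots> = card (Pow ?hyp)"
    using card_hyperedges[of "{..<N}" H d] fH by (simp add: card_Pow)
  finally have "card ((\<lambda>w. {x \<in> ?hyp. w x = 1}) ` ?ws) < card (Pow ?hyp)" .
  then have "\<not> Pow ?hyp \<subseteq> (\<lambda>w. {x \<in> ?hyp. w x = 1}) ` ?ws"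
    using ws(1) card_mono[of "(\<lambda>w. {x \<in> ?hyp. w x = 1}) ` ?ws" "Pow ?hyp"] by auto
  then obtain E where E: "E \<subseteq> ?hyp" "\<forall>w\<in>?ws. E \<noteq> {x \<in> ?hyp. w x = 1}" by blast
  then have "level d k a N H E"
    using N H unfolding level_def T_def M_def by auto
  then show ?thesis by blast
qed

lemma levels_exist:
  assumes "d \<ge> 1"
  shows "\<exists>N H E. \<forall>k. level d (Suc k) (N k) (N (Suc k)) (H k) (E k)"
proof -
  have "\<exists>N. \<forall>k. True \<and> (\<exists>H E. level d (Suc k) (N k) (N (Suc k)) H E)"
    by (rule dependent_nat_choice[where P = "\<lambda>_ _. True"]) (use level_exists[OF assms] in auto)
  then show ?thesis by metis
qed

section \<open>The independent operations\<close>

definition indicator_op :: "nat \<Rightarrow> nat list set \<Rightarrow> operation" where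
  "indicator_op n E = (n, \<lambda>xs\<in>tuples UNIV n. if xs \<in> E then 1 else 0)"

lemma indicator_op_nary: "indicator_op n E \<in> nary_operations n"
  by (simp add: nary_operations_iff indicator_op_def)

lemma fst_indicator_op: "fst (indicator_op n E) = n"
  by (simp add: indicator_op_def)

lemma two_valued_indicator_op: "two_valued (indicator_op n E)"
  by (auto simp: two_valued_iff indicator_op_def mem_tuples_iff)

lemma snd_indicator_op: "length xs = n \<Longrightarrow> snd (indicator_op n E) xs = (if xs \<in> E then 1 else 0)"
  by (simp add: indicator_op_def mem_tuples_iff)

locale level_sequence =
  fixes d :: nat and N :: "nat \<Rightarrow> nat" and H :: "nat \<Rightarrow> (nat \<times> nat) set" and E :: "nat \<Rightarrow> nat list set"
  assumes d: "d \<ge> 1" and level: "level d (Suc k) (N k) (N (Suc k)) (H k) (E k)"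
begin

lemma N_Suc: "N k \<le> N (Suc k)" "N k * N k \<le> N (Suc k)" "2 \<le> N (Suc k)" "Suc k \<le> N (Suc k)"
  using level[of k] unfolding level_def by blast+

lemma mono_N: "i \<le> j \<Longrightarrow> N i \<le> N j"
  using N_Suc(1) by (rule lift_Suc_mono_le)

lemma H_subset: "H k \<subseteq> {N k..<N (Suc k)} \<times> {N k..<N (Suc k)}"
  using level[of k] unfolding level_def by blast

lemma H_sparse: "sparse_upto (Suc k * N k) (H k)"
  using level[of k] unfolding level_def by blast

lemma E_subset: "E k \<subseteq> hyperedges d {..<N (Suc k)} (H k)"
  using level[of k] unfolding level_def by blast

lemma E_last_pair:
  assumes "x \<in> hyperedges d Z (H k)"
  obtains xs u v where "length xs = d - 1" "(u, v) \<in> H k" "x = xs @ [u, v]"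
proof -
  obtain p where p: "p \<in> tuples Z (d - 1) \<times> H k" "x = (\<lambda>(xs, u, v). xs @ [u, v]) p"
    using assms unfolding hyperedges_def by blast
  obtain xs u v where "p = (xs, u, v)" by (cases p)
  then show thesis using p by (intro that[of xs u v]) (simp_all add: mem_tuples_iff)
qed

lemma disjoint_blocks: "i \<noteq> j \<Longrightarrow> {N i..<N (Suc i)} \<inter> {N j..<N (Suc j)} = {}"
  using mono_N[of "Suc i" j] mono_N[of "Suc j" i] by (cases i j rule: linorder_cases) auto

lemma le_N: "k \<le> N k"
  using N_Suc(4)[of "k - 1"] by (cases k) auto

text \<open>
  For a set \<open>Z\<close> that occurs when level \<open>k\<close> is examined, the earlier levels contribute no more than all pairs below \<open>N k\<close>,
  and each later level is sparse on the part of \<open>Z\<close> in its own block. These parts are disjoint, so the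
  contributions of all later levels add up to at most twice the size of \<open>Z\<close>.
\<close>

lemma card_graph_other_levels:
  assumes Z: "finite Z" "card Z \<le> Suc k * N (Suc k)"
  shows "finite (\<Union>l\<in>- {k}. H l \<inter> Z \<times> Z)"
    and "card (\<Union>l\<in>- {k}. H l \<inter> Z \<times> Z) \<le> 3 * (Suc k * N (Suc k))"
proof -
  define V where "V l = Z \<inter> {N l..<N (Suc l)}" for l
  obtain b where b: "Z \<subseteq> {..<b}" using Z(1) finite_nat_iff_bounded by blast
  let ?low = "{..<N k} \<times> {..<N k}"
  let ?up = "\<Union>l\<in>{k<..<b}. H l \<inter> V l \<times> V l"
  have sub: "(\<Union>l\<in>- {k}. H l \<inter> Z \<times> Z) \<subseteq> ?low \<union> ?up"
  proof (intro UN_least subsetI)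
    fix l p assume l: "l \<in> - {k}" and p: "p \<in> H l \<inter> Z \<times> Z"
    have pV: "p \<in> V l \<times> V l" using p H_subset[of l] by (auto simp: V_def)
    show "p \<in> ?low \<union> ?up"
    proof (cases "l < k")
      case True
      then show ?thesis using pV mono_N[of "Suc l" k] by (auto simp: V_def)
    next
      case False
      have "N l < b" using pV b by (auto simp: V_def)
      then have "l < b" using le_N[of l] by simp
      then show ?thesis using False l p pV by auto
    qed
  qed
  have fin: "finite (?low \<union> ?up)" using Z(1) by (auto simp: V_def)
  then show "finite (\<Union>l\<in>- {k}. H l \<inter> Z \<times> Z)" using sub finite_subset by blast
  have edges: "card (H l \<inter> V l \<times> V l) \<le> 2 * card (V l)" if "l \<in> {k<..<b}" for l
  proof (cases "V l = {}")
    case False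
    have "card (V l) \<le> card Z" using Z(1) by (auto simp: V_def intro: card_mono)
    also have "\<dots> \<le> Suc l * N l"
      using that mono_N[of "Suc k" l] by (intro le_trans[OF Z(2)] mult_le_mono) auto
    finally have "card (V l) \<le> Suc l * N l" .
    then have "card (H l \<inter> V l \<times> V l) + 2 \<le> 2 * card (V l)"
      by (intro H_sparse[of l, unfolded sparse_upto_def, rule_format]) (use False Z(1) in \<open>simp add: V_def\<close>)
    then show ?thesis by simp
  qed simp
  have "card ?up \<le> (\<Sum>l\<in>{k<..<b}. card (H l \<inter> V l \<times> V l))" by (rule card_UN_le) simp
  also have "\<dots> \<le> (\<Sum>l\<in>{k<..<b}. 2 * card (V l))" using edges by (rule sum_mono)
  also have "\<dots> = 2 * card (\<Union>l\<in>{k<..<b}. V l)"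
  proof -
    have "card (\<Union>l\<in>{k<..<b}. V l) = (\<Sum>l\<in>{k<..<b}. card (V l))"
    proof (intro card_UN_disjoint ballI impI)
      show "V i \<inter> V j = {}" if "i \<noteq> j" for i j
        using disjoint_blocks[OF that] unfolding V_def by blast
    qed (use Z(1) in \<open>simp_all add: V_def\<close>)
    then show ?thesis by (simp add: sum_distrib_left)
  qed
  also have "\<dots> \<le> 2 * card Z" using Z(1) by (intro mult_le_mono2 card_mono) (auto simp: V_def)
  finally have up: "card ?up \<le> 2 * (Suc k * N (Suc k))" using Z(2) by linarith
  have "card ?low \<le> N (Suc k)" using N_Suc(2)[of k] by (simp add: card_cartesian_product)
  then have low: "card ?low \<le> Suc k * N (Suc k)" by simp
  have "card (\<Union>l\<in>- {k}. H l \<inter> Z \<times> Z) \<le> card (?low \<union> ?up)" using sub fin by (rule card_mono[rotated])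
  also have "\<dots> \<le> card ?low + card ?up" by (rule card_Un_le)
  finally show "card (\<Union>l\<in>- {k}. H l \<inter> Z \<times> Z) \<le> 3 * (Suc k * N (Suc k))" using up low by linarith
qed

lemma card_hyperedges_other_levels:
  assumes Z: "finite Z" "card Z \<le> Suc k * N (Suc k)" and A: "k \<notin> A"
  shows "card {zs \<in> tuples Z (Suc d). zs \<in> (\<Union>l\<in>A. E l)} \<le> 3 * (Suc k * N (Suc k)) ^ d"
proof -
  let ?G = "\<Union>l\<in>- {k}. H l \<inter> Z \<times> Z"
  let ?M = "Suc k * N (Suc k)"
  note G = card_graph_other_levels[OF Z]
  have "{zs \<in> tuples Z (Suc d). zs \<in> (\<Union>l\<in>A. E l)} \<subseteq> hyperedges d Z ?G"
  proof
    fix zs assume "zs \<in> {zs \<in> tuples Z (Suc d). zs \<in> (\<Union>l\<in>A. E l)}"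
    then obtain l where l: "l \<in> A" "zs \<in> E l" and zs: "zs \<in> tuples Z (Suc d)" by blast
    then obtain xs u v where x: "length xs = d - 1" "(u, v) \<in> H l" "zs = xs @ [u, v]"
      using E_subset[of l] E_last_pair by blast
    have "l \<noteq> k" using l(1) A by blast
    then have "(u, v) \<in> ?G" "xs \<in> tuples Z (d - 1)" using x zs by (auto simp: mem_tuples_iff)
    then show "zs \<in> hyperedges d Z ?G" using x(3) by (force simp: hyperedges_def)
  qed
  then have "card {zs \<in> tuples Z (Suc d). zs \<in> (\<Union>l\<in>A. E l)} \<le> card (hyperedges d Z ?G)"
    by (intro card_mono card_hyperedges(1)) (use Z(1) G(1) in auto)
  also have "\<dots> = card Z ^ (d - 1) * card ?G" using Z(1) G(1) by (rule card_hyperedges(2))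
  also have "\<dots> \<le> ?M ^ (d - 1) * (3 * ?M)"
    using Z(2) G(2) by (intro mult_le_mono power_mono) auto
  also have "\<dots> = 3 * (?M ^ (d - 1) * ?M)" by simp
  also have "?M ^ (d - 1) * ?M = ?M ^ d" using d by (metis power_minus_mult less_le_trans zero_less_one)
  finally show ?thesis .
qed

text \<open>
  The last two entries of a hyperedge lie in the block of its level and reveal it.
\<close>

lemma restrict_union_levels:
  assumes "k \<in> A"
  shows "{x \<in> hyperedges d {..<N (Suc k)} (H k). x \<in> (\<Union>l\<in>A. E l)} = E k"
proof -
  have "x \<in> E k" if x: "x \<in> hyperedges d {..<N (Suc k)} (H k)" and xl: "x \<in> E l" for x l
  proof -
    obtain xs u v where k: "(u, v) \<in> H k" "x = xs @ [u, v]" using x by (rule E_last_pair)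
    obtain xs' u' v' where "(u', v') \<in> H l" "x = xs' @ [u', v']"
      using xl E_subset[of l] E_last_pair by blast
    with k have "(u, v) \<in> H l" by simp
    then have "l = k" using k(1) disjoint_blocks[of l k] H_subset[of l] H_subset[of k] by blast
    then show ?thesis using xl by simp
  qed
  then show ?thesis using assms E_subset by blast
qed

text \<open>
  A circuit for the \<open>j\<close>-th operation uses finitely many generators, so there is a level \<open>k \<in> A j\<close> beyond its number of gates
  and its modesty constant \<open>a\<close> that is used by none of the other indicator operations in the circuit. On this level
  the latter are sparse, and the circuit would compute \<open>E k\<close>.
\<close>

lemma indicator_not_generated:
  assumes C: "\<forall>f\<in>C. modest f"
    and A: "infinite (A j)" "\<And>i. i \<in> U \<Longrightarrow> finite (A i \<inter> A j)"
  shows "indicator_op (Suc d) (\<Union>l\<in>A j. E l) \<notin>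
    term_ops (C \<inter> nary_operations d \<union> (\<lambda>i. indicator_op (Suc d) (\<Union>l\<in>A i. E l)) ` U) (Suc d)"
    (is "?f j \<notin> term_ops (?C \<union> ?f ` U) (Suc d)")
proof
  assume gen: "?f j \<in> term_ops (?C \<union> ?f ` U) (Suc d)"
  obtain W s where W0: "circuit (?C \<union> ?f ` U) (Suc d) W s" and fW: "?f j \<in> W"
    using term_ops_circuit[OF gen] by (elim exE conjE)
  obtain S where S: "S \<subseteq> ?C \<union> ?f ` U" "finite S" and W: "circuit S (Suc d) W s"
    using circuit_finite_generators[OF W0] by (elim exE conjE)
  obtain I where I: "I \<subseteq> U" "finite I" "S - ?C \<subseteq> ?f ` I"
  proof -
    have "finite (S - ?C)" "S - ?C \<subseteq> ?f ` U" using S by auto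
    from finite_subset_image[OF this] obtain I where "I \<subseteq> U" "finite I" "S - ?C = ?f ` I" by (elim exE conjE)
    then show thesis by (intro that[of I]) simp_all
  qed
  have mS: "\<forall>f\<in>S. modest f"
  proof
    fix f assume "f \<in> S"
    then consider "f \<in> C" | i where "f = ?f i" using S(1) by blast
    then show "modest f"
      using C by cases (simp_all add: modest_two_valued two_valued_indicator_op fst_indicator_op)
  qed
  obtain a where a: "\<And>Y. finite Y \<Longrightarrow> card (\<Union>u\<in>W. op_image u Y) \<le> a * card Y"
  proof -
    have "\<forall>u\<in>W. modest u" using modest_term_ops[OF _ mS] circuit_subset[OF W] by blast
    from card_union_op_image[OF circuit_finite[OF W] this] show thesis using that by (elim exE) blast
  qed
  have "finite (\<Union>i\<in>I. A i \<inter> A j)" using I A(2) by blast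
  then have "infinite (A j - (\<Union>i\<in>I. A i \<inter> A j))" using A(1) by (rule Diff_infinite_finite)
  then obtain k where k: "k \<in> A j" "\<And>i. i \<in> I \<Longrightarrow> k \<notin> A i" "k \<ge> s + a"
    unfolding infinite_nat_iff_unbounded_le by blast
  define n where "n = N (Suc k)"
  define M where "M = Suc k * n"
  define Z where "Z = (\<Union>u\<in>W. op_image u {..<n})"
  have n2: "n \<ge> 2" using N_Suc(3)[of k] by (simp add: n_def)
  have Z: "finite Z" using circuit_finite[OF W] by (simp add: Z_def finite_op_image)
  have "card Z \<le> a * n" using a[of "{..<n}"] by (simp add: Z_def)
  also have "\<dots> \<le> M" unfolding M_def using k(3) by (intro mult_le_mono1) simp
  finally have cZ: "card Z \<le> M" .
  have nZ: "{..<n} \<subseteq> Z"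
  proof
    fix x assume "x \<in> {..<n}"
    then have "replicate (Suc d) x \<in> tuples {..<n} (Suc d)" by (auto simp: mem_tuples_iff)
    then have "snd (projection (Suc d) 0) (replicate (Suc d) x) \<in> op_image (projection (Suc d) 0) {..<n}"
      unfolding op_image_def by (intro imageI) (simp add: projection_def)
    moreover have "snd (projection (Suc d) 0) (replicate (Suc d) x) = x" by (simp add: snd_projection)
    moreover have "projection (Suc d) 0 \<in> W" using circuit_inputs[OF W] by blast
    ultimately show "x \<in> Z" unfolding Z_def by auto
  qed
  \<comment> \<open>Renaming the values while keeping the inputs brings the circuit into the finite universe of the level.\<close>
  obtain \<phi> where \<phi>: "inj_on \<phi> Z" "\<phi> ` Z \<subseteq> {..<M}" "\<And>x. x < n \<Longrightarrow> \<phi> x = x"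
    using renaming_exists[OF Z nZ cZ] by blast
  have M0: "M > 0" using n2 by (simp add: M_def)
  let ?T = "tables d M (3 * M ^ d)"
  let ?X = "tuples {..<n} (Suc d)"
  have "transfer Z \<phi> M f \<in> ?T" if f: "f \<in> S" for f
  proof (cases "f \<in> ?C")
    case True
    then show ?thesis using \<phi>(2) M0 by (intro transfer_in_tables_arbitrary) (auto simp: nary_operations_iff)
  next
    case False
    then obtain i where i: "i \<in> I" "f = ?f i" using I(3) f by blast
    have "{zs \<in> tuples Z (Suc d). snd f zs = 1} = {zs \<in> tuples Z (Suc d). zs \<in> (\<Union>l\<in>A i. E l)}"
      unfolding i(2) by (auto simp: mem_tuples_iff snd_indicator_op split: if_splits)
    then have "card {zs \<in> tuples Z (Suc d). snd f zs = 1} \<le> 3 * M ^ d"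
      using card_hyperedges_other_levels[OF Z, of k "A i"] cZ k(2)[OF i(1)] by (simp add: M_def n_def)
    moreover have "{0, 1} \<subseteq> Z" using nZ n2 by auto
    ultimately show ?thesis
      using \<phi> n2 Z by (intro transfer_in_tables_sparse) (auto simp: i(2) fst_indicator_op two_valued_indicator_op)
  qed
  moreover have "\<forall>u\<in>W. op_image u {..<n} \<subseteq> Z" by (auto simp: Z_def)
  ultimately have "(\<lambda>u. \<lambda>x\<in>?X. \<phi> (snd u x)) ` W \<in> traces ?T (Suc d) ?X s"
    using circuit_traces[OF W _ \<phi>(1,2) nZ \<phi>(3)] by blast
  moreover have "s \<le> Suc k" using k(3) by simp
  ultimately have tr: "(\<lambda>u. \<lambda>x\<in>?X. \<phi> (snd u x)) ` W \<in> traces ?T (Suc d) ?X (Suc k)"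
    using traces_mono by blast
  define w where "w = (\<lambda>x\<in>?X. \<phi> (snd (?f j) x))"
  have all: "\<forall>V\<in>traces ?T (Suc d) ?X (Suc k). \<forall>w\<in>V. E k \<noteq> {x \<in> hyperedges d {..<n} (H k). w x = 1}"
    using level[of k] unfolding level_def n_def[symmetric] M_def[symmetric] by (elim conjE)
  have "w \<in> (\<lambda>u. \<lambda>x\<in>?X. \<phi> (snd u x)) ` W" unfolding w_def using fW by (rule imageI)
  then have "E k \<noteq> {x \<in> hyperedges d {..<n} (H k). w x = 1}" by (rule bspec[OF bspec[OF all tr]])
  moreover have "w x = 1 \<longleftrightarrow> x \<in> (\<Union>l\<in>A j. E l)" if x: "x \<in> hyperedges d {..<n} (H k)" for x
  proof -
    have "H k \<subseteq> {..<n} \<times> {..<n}" using H_subset[of k] by (auto simp: n_def)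
    then have "x \<in> ?X" using hyperedges_tuples[OF d] x by blast
    then show ?thesis using \<phi>(3)[of 0] \<phi>(3)[of 1] n2
      by (auto simp: w_def snd_indicator_op mem_tuples_iff split: if_splits)
  qed
  then have "{x \<in> hyperedges d {..<n} (H k). w x = 1} = E k"
    using restrict_union_levels[OF k(1)] unfolding n_def by blast
  ultimately show False by simp
qed

end

section \<open>Very many clones\<close>

text \<open>
  The branches of the binary tree: \<open>j\<close> is mapped to the set of codes of its initial segments \<open>j \<inter> {..<n}\<close>. The
  length \<open>n\<close> belongs to the code, so that finite sets \<open>j\<close> also have infinitely many codes.
\<close>

lemma almost_disjoint_family:
  "\<exists>A :: nat set \<Rightarrow> nat set. (\<forall>j. infinite (A j)) \<and> (\<forall>i j. i \<noteq> j \<longrightarrow> finite (A i \<inter> A j))"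
proof -
  define c where "c j n = prod_encode (n, set_encode (j \<inter> {..<n}))" for j n
  have c: "n = m \<and> i \<inter> {..<n} = j \<inter> {..<n}" if "c i n = c j m" for i j n m
    using that by (auto simp: c_def set_encode_eq)
  have "infinite (range (c j))" for j
    using c by (intro range_inj_infinite) (auto simp: inj_on_def)
  moreover have "finite (range (c i) \<inter> range (c j))" if ij: "i \<noteq> j" for i j
  proof -
    obtain x where x: "x \<in> i \<longleftrightarrow> x \<notin> j" using ij by blast
    have "range (c i) \<inter> range (c j) \<subseteq> c i ` {..x}"
    proof
      fix y assume "y \<in> range (c i) \<inter> range (c j)"
      then obtain n m where nm: "y = c i n" "y = c j m" by blast
      then have "c i n = c j m" by simp
      then have "i \<inter> {..<n} = j \<inter> {..<n}" using c by blast
      then have "\<not> x < n" using x by blast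
      then show "y \<in> c i ` {..x}" using nm(1) by auto
    qed
    then show ?thesis using finite_surj by blast
  qed
  ultimately show ?thesis by (intro exI[of _ "\<lambda>j. range (c j)"]) blast
qed

lemma operations_lepoll: "operations \<lesssim> (UNIV :: nat set set)"
proof -
  obtain e :: "nat \<times> nat list \<times> nat \<Rightarrow> nat" where e: "inj e" using ex_inj by blast
  define g :: "operation \<Rightarrow> nat set" where "g f = e ` {(fst f, xs, snd f xs) | xs. True}" for f
  have "inj g"
  proof (rule injI)
    fix f h assume "g f = g h"
    then have eq: "{(fst f, xs, snd f xs) | xs. True} = {(fst h, xs, snd h xs) | xs. True}"
      using inj_image_eq_iff[OF e] by (simp add: g_def)
    have "(fst f, xs, snd f xs) \<in> {(fst h, xs, snd h xs) | xs. True}" for xs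
      unfolding eq[symmetric] by blast
    then show "f = h" by (intro prod_eqI ext) auto
  qed
  then show ?thesis by (meson inj_on_subset lepoll_def subset_UNIV)
qed

theorem theorem1p3:
  fixes d :: nat and C :: "operation set"
  assumes "d \<ge> 1"
    and "modest_clone C"
    and "\<forall>f\<in>nary_operations d. op_image f UNIV = {0, 1} \<longrightarrow> f \<in> C"
  shows "{D. clone D \<and> D \<inter> nary_operations d = C \<inter> nary_operations d}
           \<approx> Pow (Pow (UNIV :: nat set))"
    (is "?\<D> \<approx> _")
proof (rule lepoll_antisym)
  have "?\<D> \<subseteq> Pow operations" by (auto simp: clone_def)
  then have "?\<D> \<lesssim> Pow operations" by (rule subset_imp_lepoll)
  also have "Pow operations \<lesssim> Pow (Pow (UNIV :: nat set))"
  proof -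
    obtain g :: "operation \<Rightarrow> nat set" where "inj_on g operations"
      using operations_lepoll unfolding lepoll_def by blast
    then have "inj_on (image g) (Pow operations)" by (rule inj_on_image_Pow)
    then show ?thesis unfolding lepoll_def by blast
  qed
  finally show "?\<D> \<lesssim> Pow (Pow (UNIV :: nat set))" .
next
  have C: "clone C" "\<forall>f\<in>C. modest f" using assms(2) by (auto simp: modest_clone_def)
  obtain N H E where "\<forall>k. level d (Suc k) (N k) (N (Suc k)) (H k) (E k)"
    using levels_exist[OF assms(1)] by blast
  then interpret level_sequence d N H E using assms(1) by unfold_locales auto
  obtain A :: "nat set \<Rightarrow> nat set" where A: "\<And>j. infinite (A j)" "\<And>i j. i \<noteq> j \<Longrightarrow> finite (A i \<inter> A j)"
    using almost_disjoint_family by blast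
  let ?f = "\<lambda>j. indicator_op (Suc d) (\<Union>l\<in>A j. E l)"
  define S where "S U = C \<inter> nary_operations d \<union> ?f ` U" for U
  define D where "D U = generated_clone (S U)" for U
  have mem: "?f j \<in> D U \<longleftrightarrow> j \<in> U" for j U
  proof -
    have "?f j \<in> D U \<longleftrightarrow> ?f j \<in> term_ops (S U) (Suc d)"
      using generated_clone_nary[of "Suc d" "S U"] indicator_op_nary unfolding D_def by auto
    moreover have "?f j \<in> term_ops (S U) (Suc d)" if "j \<in> U"
      using that indicator_op_nary by (intro generator_in_term_ops) (auto simp: S_def)
    moreover have "?f j \<notin> term_ops (S U) (Suc d)" if "j \<notin> U"
      unfolding S_def by (intro indicator_not_generated C(2) A) (use that in blast)
    ultimately show ?thesis by blast
  qed
  have "inj_on D (Pow (Pow UNIV))"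
  proof (rule inj_onI, rule set_eqI)
    fix U V j assume "D U = D V"
    then show "j \<in> U \<longleftrightarrow> j \<in> V" using mem[of j U] mem[of j V] by simp
  qed
  moreover have "D ` Pow (Pow UNIV) \<subseteq> ?\<D>"
  proof (rule image_subsetI)
    fix U
    have "D U \<inter> nary_operations d = C \<inter> nary_operations d"
      unfolding D_def S_def using two_valued_indicator_op
      by (intro generated_clone_fragment[OF C(1) assms(1,3)]) auto
    then show "D U \<in> ?\<D>" by (simp add: D_def clone_generated_clone)
  qed
  ultimately show "Pow (Pow (UNIV :: nat set)) \<lesssim> ?\<D>"
    unfolding lepoll_def by blast
qed

end
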